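(* Let $(A,\circ)$ be a finite-dimensional Novikov algebra over $\mathbf{k}$ and $(V,l_A,r_A)$ a finite-dimensional representation. Let $T:V\to A$ be a linear map, identified with an element $r_T\in A\otimes V^*\subseteq(A\ltimes_{l_A^*+r_A^*,-r_A^*}V^* )\otimes(A\ltimes_{l_A^*+r_A^*,-r_A^*}V^* )$ through $\mathrm{Hom}_{\mathbf{k}}(V,A)\cong A\otimes V^*$. Then $r=r_T-\tau r_T$ is a solution of the Novikov Yang-Baxter equation in the Novikov algebra $A\ltimes_{l_A^*+r_A^*,-r_A^*}V^*$ if and only if $T$ is an $\mathcal{O}$-operator of $(A,\circ)$ associated to $(V,l_A,r_A)$.
   Context: $\mathbf{k}$ is a field of characteristic zero; $\tau(x\otimes y)=y\otimes x$. A Novikov algebra $(A,\circ)$: $(a\circ b)\circ c-a\circ(b\circ c)=(b\circ a)\circ c-b\circ(a\circ c)$ and $(a\circ b)\circ c=(a\circ c)\circ b$. A representation $(V,l_A,r_A)$: linear maps $l_A,r_A:A\to\mathrm{End}_{\mathbf{k}}(V)$ with $l_A(a\circ b-b\circ a)=l_A(a)l_A(b)-l_A(b)l_A(a)$, $l_A(a)r_A(b)-r_A(b)l_A(a)=r_A(a\circ b)-r_A(b)r_A(a)$, $l_A(a\circ b)=r_A(b)l_A(a)$, $r_A(a)r_A(b)=r_A(b)r_A(a)$ for all $a,b\in A$. For $\varphi:A\to\mathrm{End}(V)$, $\varphi^*:A\to\mathrm{End}(V^* )$ is given by $\langle\varphi^*(a)f,v\rangle=-\langle f,\varphi(a)v\rangle$.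 Then $(V^*,l_A^*+r_A^*,-r_A^* )$ is a representation. For a representation $(W,l,r)$, the semi-direct product $A\ltimes_{l,r}W$ is the Novikov algebra $A\oplus W$ with product $(a+u)\bullet(b+v)=a\circ b+l(a)v+r(b)u$. With a basis $(v_i)$ of $V$ and dual basis $(v_i^* )$, $r_T=\sum_iT(v_i)\otimes v_i^*$. An $\mathcal{O}$-operator of $(A,\circ)$ associated to $(V,l_A,r_A)$ is a linear map $T:V\to A$ with $T(u)\circ T(v)=T(l_A(T(u))v)+T(r_A(T(v))u)$ for all $u,v\in V$. For a Novikov algebra $(N,\circ)$ and $r=\sum_\alpha x_\alpha\otimes y_\alpha\in N\otimes N$, the Novikov Yang-Baxter equation (NYBE) in $N$ is $$\sum_{\alpha,\beta}\big(x_\alpha\otimes x_\beta\otimes y_\alpha\circ y_\beta+x_\alpha\otimes(y_\alpha\circ x_\beta+x_\beta\circ y_\alpha)\otimes y_\beta+x_\alpha\circ x_\beta\otimes y_\beta\otimes y_\alpha\big)=0.$$ *)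

theory Defs
  imports
    Complex_Main
    "HOL-Library.Poly_Mapping"
    "HOL-Library.Function_Algebras"
    "HOL-Library.Product_Plus"
begin

section \<open>Tensor powers of a subspace\<close>

text \<open>
  The tensor power of order n of a subspace N is the quotient of the free vector space on the
  lists of length n with entries in N by the multilinearity relations. Formal sums are elements
  of the free space, and a tensor is a coset. Working with a carrier N is forced by the dual
  space, which depends on term parameters and hence is not a type.
\<close>

definition formal_scale :: "'k::field \<Rightarrow> ('x \<Rightarrow>\<^sub>0 'k) \<Rightarrow> ('x \<Rightarrow>\<^sub>0 'k)" where
  "formal_scale c p = Poly_Mapping.map ((*) c) p"

definition formal_pure :: "'n list \<Rightarrow> ('n list \<Rightarrow>\<^sub>0 'k::field)" where
  "formal_pure xs = Poly_Mapping.single xs 1"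

definition multilinearity_relations ::
    "('k::field \<Rightarrow> 'n::ab_group_add \<Rightarrow> 'n) \<Rightarrow> 'n set \<Rightarrow> nat \<Rightarrow> ('n list \<Rightarrow>\<^sub>0 'k) set" where
  "multilinearity_relations s N n =
     {formal_pure (us @ (x + y) # vs) - formal_pure (us @ x # vs) - formal_pure (us @ y # vs)
        | us vs x y. set us \<subseteq> N \<and> set vs \<subseteq> N \<and> x \<in> N \<and> y \<in> N \<and> length us + length vs + 1 = n} \<union>
     {formal_pure (us @ s c x # vs) - formal_scale c (formal_pure (us @ x # vs))
        | us vs c x. set us \<subseteq> N \<and> set vs \<subseteq> N \<and> x \<in> N \<and> length us + length vs + 1 = n}"

definition null_tensors ::
    "('k::field \<Rightarrow> 'n::ab_group_add \<Rightarrow> 'n) \<Rightarrow> 'n set \<Rightarrow> nat \<Rightarrow> ('n list \<Rightarrow>\<^sub>0 'k) set" where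
  "null_tensors s N n = module.span formal_scale (multilinearity_relations s N n)"

definition tensor_class ::
    "('k::field \<Rightarrow> 'n::ab_group_add \<Rightarrow> 'n) \<Rightarrow> 'n set \<Rightarrow> nat \<Rightarrow> ('n list \<Rightarrow>\<^sub>0 'k) \<Rightarrow> ('n list \<Rightarrow>\<^sub>0 'k) set" where
  "tensor_class s N n p = {q. q - p \<in> null_tensors s N n}"

text \<open>
  On formal sums of lists of length two this is the flip: pulling back along the involution
  \<^const>\<open>rev\<close> sends the generator [x, y] to [y, x].
\<close>

definition formal_flip :: "('n list \<Rightarrow>\<^sub>0 'k::field) \<Rightarrow> ('n list \<Rightarrow>\<^sub>0 'k)" where
  "formal_flip p = Poly_Mapping.map_key rev p"


section \<open>Novikov algebras and their representations\<close>

locale novikov_algebra = vector_space s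
  for s :: "'k::field \<Rightarrow> 'a::ab_group_add \<Rightarrow> 'a" +
  fixes A :: "'a set" and mul :: "'a \<Rightarrow> 'a \<Rightarrow> 'a"
  assumes subspace_carrier: "subspace A"
    and mul_closed: "a \<in> A \<Longrightarrow> b \<in> A \<Longrightarrow> mul a b \<in> A"
    and mul_add_left: "a \<in> A \<Longrightarrow> b \<in> A \<Longrightarrow> c \<in> A \<Longrightarrow> mul (a + b) c = mul a c + mul b c"
    and mul_add_right: "a \<in> A \<Longrightarrow> b \<in> A \<Longrightarrow> c \<in> A \<Longrightarrow> mul a (b + c) = mul a b + mul a c"
    and mul_scale_left: "a \<in> A \<Longrightarrow> b \<in> A \<Longrightarrow> mul (s k a) b = s k (mul a b)"
    and mul_scale_right: "a \<in> A \<Longrightarrow> b \<in> A \<Longrightarrow> mul a (s k b) = s k (mul a b)"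
    and left_symmetric: "a \<in> A \<Longrightarrow> b \<in> A \<Longrightarrow> c \<in> A \<Longrightarrow>
      mul (mul a b) c - mul a (mul b c) = mul (mul b a) c - mul b (mul a c)"
    and right_commutative: "a \<in> A \<Longrightarrow> b \<in> A \<Longrightarrow> c \<in> A \<Longrightarrow> mul (mul a b) c = mul (mul a c) b"

locale novikov_representation =
  novikov_algebra s A mul + V: vector_space t
  for s :: "'k::field \<Rightarrow> 'a::ab_group_add \<Rightarrow> 'a" and A :: "'a set" and mul :: "'a \<Rightarrow> 'a \<Rightarrow> 'a"
    and t :: "'k \<Rightarrow> 'v::ab_group_add \<Rightarrow> 'v" +
  fixes V :: "'v set" and l r :: "'a \<Rightarrow> 'v \<Rightarrow> 'v"
  assumes V_subspace: "V.subspace V"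
    and l_closed: "a \<in> A \<Longrightarrow> v \<in> V \<Longrightarrow> l a v \<in> V"
    and r_closed: "a \<in> A \<Longrightarrow> v \<in> V \<Longrightarrow> r a v \<in> V"
    and l_add: "a \<in> A \<Longrightarrow> v \<in> V \<Longrightarrow> w \<in> V \<Longrightarrow> l a (v + w) = l a v + l a w"
    and r_add: "a \<in> A \<Longrightarrow> v \<in> V \<Longrightarrow> w \<in> V \<Longrightarrow> r a (v + w) = r a v + r a w"
    and l_scale: "a \<in> A \<Longrightarrow> v \<in> V \<Longrightarrow> l a (t k v) = t k (l a v)"
    and r_scale: "a \<in> A \<Longrightarrow> v \<in> V \<Longrightarrow> r a (t k v) = t k (r a v)"
    and l_add_arg: "a \<in> A \<Longrightarrow> b \<in> A \<Longrightarrow> v \<in> V \<Longrightarrow> l (a + b) v = l a v + l b v"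
    and r_add_arg: "a \<in> A \<Longrightarrow> b \<in> A \<Longrightarrow> v \<in> V \<Longrightarrow> r (a + b) v = r a v + r b v"
    and l_scale_arg: "a \<in> A \<Longrightarrow> v \<in> V \<Longrightarrow> l (s k a) v = t k (l a v)"
    and r_scale_arg: "a \<in> A \<Longrightarrow> v \<in> V \<Longrightarrow> r (s k a) v = t k (r a v)"
    and l_commutator: "a \<in> A \<Longrightarrow> b \<in> A \<Longrightarrow> v \<in> V \<Longrightarrow>
      l (mul a b - mul b a) v = l a (l b v) - l b (l a v)"
    and l_r_commutator: "a \<in> A \<Longrightarrow> b \<in> A \<Longrightarrow> v \<in> V \<Longrightarrow>
      l a (r b v) - r b (l a v) = r (mul a b) v - r b (r a v)"
    and l_mul: "a \<in> A \<Longrightarrow> b \<in> A \<Longrightarrow> v \<in> V \<Longrightarrow> l (mul a b) v = r b (l a v)"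
    and r_commute: "a \<in> A \<Longrightarrow> b \<in> A \<Longrightarrow> v \<in> V \<Longrightarrow> r a (r b v) = r b (r a v)"

definition dual_space :: "('k::field \<Rightarrow> 'v::ab_group_add \<Rightarrow> 'v) \<Rightarrow> ('v \<Rightarrow> 'k) set" where
  "dual_space t = {f. Vector_Spaces.linear t (*) f}"

definition dual_scale :: "'k::field \<Rightarrow> ('v \<Rightarrow> 'k) \<Rightarrow> ('v \<Rightarrow> 'k)" where
  "dual_scale c f = (\<lambda>v. c * f v)"

definition dual_action :: "('a \<Rightarrow> 'v \<Rightarrow> 'v) \<Rightarrow> 'a \<Rightarrow> ('v \<Rightarrow> 'k::field) \<Rightarrow> ('v \<Rightarrow> 'k)" where
  "dual_action \<phi> a f = (\<lambda>v. - f (\<phi> a v))"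

definition sum_scale ::
    "('k \<Rightarrow> 'a \<Rightarrow> 'a) \<Rightarrow> ('k \<Rightarrow> 'w \<Rightarrow> 'w) \<Rightarrow> 'k \<Rightarrow> 'a \<times> 'w \<Rightarrow> 'a \<times> 'w" where
  "sum_scale s t c = map_prod (s c) (t c)"

definition semidirect_mul ::
    "('a \<Rightarrow> 'a \<Rightarrow> 'a) \<Rightarrow> ('a \<Rightarrow> 'w \<Rightarrow> 'w) \<Rightarrow> ('a \<Rightarrow> 'w \<Rightarrow> 'w) \<Rightarrow>
     'a \<times> 'w \<Rightarrow> 'a \<times> 'w \<Rightarrow> 'a \<times> 'w::ab_group_add" where
  "semidirect_mul mul l r = (\<lambda>(a, u) (b, v). (mul a b, l a v + r b u))"

definition o_operator ::
    "('k::field \<Rightarrow> 'a::ab_group_add \<Rightarrow> 'a) \<Rightarrow> ('a \<Rightarrow> 'a \<Rightarrow> 'a) \<Rightarrow> ('k \<Rightarrow> 'v::ab_group_add \<Rightarrow> 'v) \<Rightarrow>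
     ('a \<Rightarrow> 'v \<Rightarrow> 'v) \<Rightarrow> ('a \<Rightarrow> 'v \<Rightarrow> 'v) \<Rightarrow> ('v \<Rightarrow> 'a) \<Rightarrow> bool" where
  "o_operator s mul t l r T \<longleftrightarrow> Vector_Spaces.linear t s T \<and>
     (\<forall>u v. mul (T u) (T v) = T (l (T u) v) + T (r (T v) u))"

lemma add_three_relations:
  fixes a b :: "'b::ab_group_add"
  assumes "a - b = c - d" "e - f = g - h" "e' - f' = g' - h'"
  shows "d + (e' + (a + (f + (h' + g)))) = c + (e + (b + (f' + (h + g'))))"
proof -
  have "d + (e' + (a + (f + (h' + g)))) - (c + (e + (b + (f' + (h + g'))))) =
      ((a - b) - (c - d)) + ((e' - f') - (g' - h')) - ((e - f) - (g - h))"
    by (simp add: algebra_simps)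
  then show ?thesis using assms by simp
qed

lemma (in novikov_representation) semidirect_novikov_algebra:
  "novikov_algebra (sum_scale s t) (A \<times> V) (semidirect_mul mul l r)"
proof -
  interpret P: vector_space "sum_scale s t"
    by unfold_locales (auto simp: sum_scale_def scale_right_distrib scale_left_distrib
        V.scale_right_distrib V.scale_left_distrib)
  note A = subspace_carrier[THEN subspace_add] subspace_carrier[THEN subspace_diff]
    subspace_carrier[THEN subspace_scale]
  note V = V_subspace[THEN V.subspace_add] V_subspace[THEN V.subspace_diff]
    V_subspace[THEN V.subspace_scale]
  have l_diff: "l (a - b) v = l a v - l b v" if "a \<in> A" "b \<in> A" "v \<in> V" for a b v
    using l_add_arg[of "a - b" b v] that A by (simp add: algebra_simps)
  show ?thesis
  proof unfold_locales
    show "P.subspace (A \<times> V)"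
      using subspace_carrier V_subspace
      by (auto simp: P.subspace_def subspace_def V.subspace_def sum_scale_def zero_prod_def)
  next
    fix x y z
    assume xyz: "x \<in> A \<times> V" "y \<in> A \<times> V" "z \<in> A \<times> V"
    obtain a u b v c w where e: "x = (a, u)" "y = (b, v)" "z = (c, w)"
      and m: "a \<in> A" "b \<in> A" "c \<in> A" "u \<in> V" "v \<in> V" "w \<in> V"
      using xyz by auto
    have "l (mul a b) w - l (mul b a) w = l a (l b w) - l b (l a w)"
      using l_commutator[of a b w] l_diff[of "mul a b" "mul b a" w] m by (simp add: mul_closed)
    note comp = add_three_relations[OF this l_r_commutator[of a c v] l_r_commutator[of b c u]]
    show "semidirect_mul mul l r (semidirect_mul mul l r x y) z
          - semidirect_mul mul l r x (semidirect_mul mul l r y z)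
        = semidirect_mul mul l r (semidirect_mul mul l r y x) z
          - semidirect_mul mul l r y (semidirect_mul mul l r x z)"
      using m left_symmetric[of a b c] comp
      by (simp add: e semidirect_mul_def l_add r_add l_closed r_closed) (simp add: algebra_simps)
    show "semidirect_mul mul l r (semidirect_mul mul l r x y) z
        = semidirect_mul mul l r (semidirect_mul mul l r x z) y"
      using m right_commutative[of a b c] l_mul[of a b w] l_mul[of a c v] r_commute[of c b u]
      by (simp add: e semidirect_mul_def l_add r_add l_closed r_closed)
  qed (auto simp: semidirect_mul_def sum_scale_def mul_closed mul_add_left mul_add_right
      mul_scale_left mul_scale_right l_closed r_closed l_add r_add l_scale r_scale l_add_arg
      r_add_arg l_scale_arg r_scale_arg V V.scale_right_distrib)
qed

lemma dual_novikov_representation: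
  assumes "novikov_representation s A mul t UNIV l r"
  shows "novikov_representation s A mul dual_scale (dual_space t)
    (dual_action l + dual_action r) (- dual_action r)"
proof -
  interpret novikov_representation s A mul t UNIV l r by fact
  interpret D: vector_space "dual_scale :: 'a \<Rightarrow> ('c \<Rightarrow> 'a) \<Rightarrow> _"
    by unfold_locales (auto simp: dual_scale_def fun_eq_iff algebra_simps)
  have "vector_space ((*) :: 'a \<Rightarrow> 'a \<Rightarrow> 'a)"
    by unfold_locales (auto simp: algebra_simps)
  then have mem: "f \<in> dual_space t \<longleftrightarrow>
      (\<forall>v w. f (v + w) = f v + f w) \<and> (\<forall>k v. f (t k v) = k * f v)" for f
    by (auto simp: dual_space_def Vector_Spaces.linear_def module_hom_def module_hom_axioms_def
        V.vector_space_axioms module_iff_vector_space)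
  have diff: "f (v - w) = f v - f w" if "f \<in> dual_space t" for f v w
    using that unfolding mem by (metis add_diff_cancel diff_add_cancel)
  show ?thesis
  proof unfold_locales
    show "D.subspace (dual_space t)"
      by (auto simp: D.subspace_def mem dual_scale_def algebra_simps)
  next
    fix a b f assume m: "a \<in> A" "b \<in> A" "f \<in> dual_space t"
    have ab: "mul a b \<in> A" "mul b a \<in> A"
      using m by (simp_all add: mul_closed)
    have add: "f (v + w) = f v + f w" for v w
      using m by (simp add: mem)
    have sub: "f (v - w) = f v - f w" for v w
      using m by (simp add: diff)
    have l_sub: "l (mul a b - mul b a) v = l (mul a b) v - l (mul b a) v"
      and r_sub: "r (mul a b - mul b a) v = r (mul a b) v - r (mul b a) v" for v
      using l_add_arg[of "mul a b - mul b a" "mul b a" v] r_add_arg[of "mul a b - mul b a" "mul b a" v] ab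
        subspace_diff[OF subspace_carrier ab] by (simp_all add: algebra_simps)
    have 1: "f (l (mul a b) v) - f (l (mul b a) v) = f (l a (l b v)) - f (l b (l a v))" for v
      using arg_cong[OF l_commutator[of a b v], of f] m by (simp add: diff l_sub)
    have 2: "f (l a (r b v)) - f (r b (l a v)) = f (r (mul a b) v) - f (r b (r a v))"
      and 3: "f (l b (r a v)) - f (r a (l b v)) = f (r (mul b a) v) - f (r a (r b v))" for v
      using arg_cong[OF l_r_commutator[of a b v], of f] arg_cong[OF l_r_commutator[of b a v], of f] m
      by (simp_all add: diff)
    have 4: "l (mul a b) v = r b (l a v)" and 5: "l (mul b a) v = r a (l b v)"
      and 6: "r a (r b v) = r b (r a v)" for v
      using l_mul[of a b v] l_mul[of b a v] r_commute[of a b v] m by auto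
    let ?l = "dual_action l + dual_action r" and ?r = "- dual_action r"
    show "?l (mul a b - mul b a) f = ?l a (?l b f) - ?l b (?l a f)"
    proof
      fix v
      show "?l (mul a b - mul b a) f v = (?l a (?l b f) - ?l b (?l a f)) v"
        using 1[of v] 2[of v] 3[of v]
        by (simp add: dual_action_def add sub l_sub r_sub 4 5 6) algebra?
    qed
    show "?l a (?r b f) - ?r b (?l a f) = ?r (mul a b) f - ?r b (?r a f)"
    proof
      fix v
      show "(?l a (?r b f) - ?r b (?l a f)) v = (?r (mul a b) f - ?r b (?r a f)) v"
        using 1[of v] 2[of v] 3[of v]
        by (simp add: dual_action_def add sub l_sub r_sub 4 5 6) algebra?
    qed
    show "?l (mul a b) f = ?r b (?l a f)"
    proof
      fix v
      show "?l (mul a b) f v = ?r b (?l a f) v"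
        using 1[of v] 2[of v] 3[of v]
        by (simp add: dual_action_def add sub l_sub r_sub 4 5 6) algebra?
    qed
    show "?r a (?r b f) = ?r b (?r a f)"
      by (simp add: dual_action_def fun_eq_iff 6)
  qed (auto simp: mem dual_action_def dual_scale_def l_add r_add l_scale r_scale l_add_arg
      r_add_arg l_scale_arg r_scale_arg fun_eq_iff algebra_simps)
qed


section \<open>The Novikov Yang-Baxter equation\<close>

definition nybe_expression ::
    "('n \<Rightarrow> 'n \<Rightarrow> 'n::ab_group_add) \<Rightarrow> nat \<Rightarrow> (nat \<Rightarrow> 'n) \<Rightarrow> (nat \<Rightarrow> 'n) \<Rightarrow> ('n list \<Rightarrow>\<^sub>0 'k::field)" where
  "nybe_expression mul n x y = (\<Sum>\<alpha><n. \<Sum>\<beta><n.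
       formal_pure [x \<alpha>, x \<beta>, mul (y \<alpha>) (y \<beta>)]
     + formal_pure [x \<alpha>, mul (y \<alpha>) (x \<beta>) + mul (x \<beta>) (y \<alpha>), y \<beta>]
     + formal_pure [mul (x \<alpha>) (x \<beta>), y \<beta>, y \<alpha>])"

text \<open>
  The equation is imposed on some presentation of the tensor \<open>R\<close> as a sum of pure tensors;
  the lemma \<open>nybe_iff\<close> below shows that the choice of presentation is immaterial.
\<close>

definition nybe ::
    "('k::field \<Rightarrow> 'n::ab_group_add \<Rightarrow> 'n) \<Rightarrow> 'n set \<Rightarrow> ('n \<Rightarrow> 'n \<Rightarrow> 'n) \<Rightarrow> ('n list \<Rightarrow>\<^sub>0 'k) set \<Rightarrow> bool" where
  "nybe s N mul R \<longleftrightarrow> (\<exists>n x y.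
     (\<forall>\<alpha><n. x \<alpha> \<in> N \<and> y \<alpha> \<in> N) \<and>
     R = tensor_class s N 2 (\<Sum>\<alpha><n. formal_pure [x \<alpha>, y \<alpha>]) \<and>
     tensor_class s N 3 (nybe_expression mul n x y) = tensor_class s N 3 0)"

text \<open>
  The tensor of \<open>T\<close>, embedded in the tensor square of the direct sum of the algebra and the dual
  space: for \<open>b\<close> in the basis \<open>B\<close>, the dual basis vector is the \<open>b\<close>-coordinate functional.
\<close>

definition formal_of_map ::
    "('k::field \<Rightarrow> 'v::ab_group_add \<Rightarrow> 'v) \<Rightarrow> 'v set \<Rightarrow> ('v \<Rightarrow> 'a::ab_group_add) \<Rightarrow>
     (('a \<times> ('v \<Rightarrow> 'k)) list \<Rightarrow>\<^sub>0 'k)" where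
  "formal_of_map t B T =
     (\<Sum>b\<in>B. formal_pure [(T b, 0), (0, \<lambda>v. module.representation t B v b)])"


section \<open>Well-definedness\<close>

lemma lookup_formal_scale [simp]:
  "Poly_Mapping.lookup (formal_scale c p) k = c * Poly_Mapping.lookup p k"
  by (simp add: formal_scale_def Poly_Mapping.map.rep_eq when_def)

global_interpretation formal: vector_space formal_scale
  by unfold_locales
    (auto intro!: poly_mapping_eqI simp: lookup_add algebra_simps)

lemma subspace_null_tensors: "formal.subspace (null_tensors s N n)"
  by (simp add: null_tensors_def)

lemma tensor_class_eq_iff:
  "tensor_class s N n p = tensor_class s N n q \<longleftrightarrow> p - q \<in> null_tensors s N n"
proof
  assume "tensor_class s N n p = tensor_class s N n q"
  moreover have "p \<in> tensor_class s N n p"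
    by (simp add: tensor_class_def formal.subspace_0[OF subspace_null_tensors])
  ultimately show "p - q \<in> null_tensors s N n"
    by (simp add: tensor_class_def)
next
  assume a: "p - q \<in> null_tensors s N n"
  have "z - p \<in> null_tensors s N n \<longleftrightarrow> z - q \<in> null_tensors s N n" for z
    using formal.subspace_add[OF subspace_null_tensors a, of "z - p"]
      formal.subspace_diff[OF subspace_null_tensors _ a, of "z - q"] by auto
  then show "tensor_class s N n p = tensor_class s N n q"
    by (simp add: tensor_class_def)
qed

lemma formal_flip_pure: "formal_flip (formal_pure [x, y]) = formal_pure [y, x]"
proof -
  have "rev [y, x] = [x, y]" by simp
  then show ?thesis
    unfolding formal_flip_def formal_pure_def by (metis map_key_single inj_on_rev)
qed

definition formal_extend :: "('x \<Rightarrow> ('y \<Rightarrow>\<^sub>0 'k)) \<Rightarrow> ('x \<Rightarrow>\<^sub>0 'k) \<Rightarrow> ('y \<Rightarrow>\<^sub>0 'k::field)" where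
  "formal_extend f p = (\<Sum>k\<in>Poly_Mapping.keys p. formal_scale (Poly_Mapping.lookup p k) (f k))"

lemma formal_extend_superset:
  assumes "finite S" "Poly_Mapping.keys p \<subseteq> S"
  shows "formal_extend f p = (\<Sum>k\<in>S. formal_scale (Poly_Mapping.lookup p k) (f k))"
  unfolding formal_extend_def
  using assms by (intro sum.mono_neutral_left) (auto simp: in_keys_iff)

lemma formal_extend_hom:
  fixes f :: "'x \<Rightarrow> ('y \<Rightarrow>\<^sub>0 'k::field)"
  shows "module_hom formal_scale formal_scale (formal_extend f)"
proof (intro module_hom.intro module_hom_axioms.intro formal.module_axioms)
  fix p q :: "'x \<Rightarrow>\<^sub>0 'k" and c
  let ?S = "Poly_Mapping.keys p \<union> Poly_Mapping.keys q"
  have "Poly_Mapping.keys (p + q) \<subseteq> ?S" by (rule keys_add)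
  then have "formal_extend f (p + q) =
      (\<Sum>k\<in>?S. formal_scale (Poly_Mapping.lookup (p + q) k) (f k))"
    by (intro formal_extend_superset) auto
  also have "\<dots> = (\<Sum>k\<in>?S. formal_scale (Poly_Mapping.lookup p k) (f k)) +
      (\<Sum>k\<in>?S. formal_scale (Poly_Mapping.lookup q k) (f k))"
    by (simp add: lookup_add formal.scale_left_distrib sum.distrib)
  also have "\<dots> = formal_extend f p + formal_extend f q"
    by (simp add: formal_extend_superset[of ?S])
  finally show "formal_extend f (p + q) = formal_extend f p + formal_extend f q" .
  have "Poly_Mapping.keys (formal_scale c p) \<subseteq> Poly_Mapping.keys p"
    by (auto simp: in_keys_iff)
  then have "formal_extend f (formal_scale c p) =
      (\<Sum>k\<in>Poly_Mapping.keys p. formal_scale (Poly_Mapping.lookup (formal_scale c p) k) (f k))"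
    by (intro formal_extend_superset) auto
  also have "\<dots> = formal_scale c (formal_extend f p)"
    by (simp add: formal_extend_def formal.scale_sum_right)
  finally show "formal_extend f (formal_scale c p) = formal_scale c (formal_extend f p)" .
qed

lemma formal_extend_pure [simp]: "formal_extend f (formal_pure xs) = f xs"
  by (simp add: formal_extend_def formal_pure_def)

lemmas formal_extend_zero = module_hom.zero[OF formal_extend_hom]
lemmas formal_extend_add = module_hom.add[OF formal_extend_hom]
lemmas formal_extend_diff = module_hom.diff[OF formal_extend_hom]
lemmas formal_extend_scale = module_hom.scale[OF formal_extend_hom]
lemmas formal_extend_sum = module_hom.sum[OF formal_extend_hom]

lemma context_length2:
  assumes "length us + length vs + 1 = 2"
  shows "(\<exists>z. us = [z] \<and> vs = []) \<or> (\<exists>z. us = [] \<and> vs = [z])"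
  using assms by (cases us; cases vs) auto

lemma formal_extend_null:
  assumes p: "p \<in> null_tensors s N 2"
    and add1: "\<And>x x' y. x \<in> N \<Longrightarrow> x' \<in> N \<Longrightarrow> y \<in> N \<Longrightarrow> f [x + x', y] - f [x, y] - f [x', y] \<in> null_tensors s N 3"
    and add2: "\<And>x y y'. x \<in> N \<Longrightarrow> y \<in> N \<Longrightarrow> y' \<in> N \<Longrightarrow> f [x, y + y'] - f [x, y] - f [x, y'] \<in> null_tensors s N 3"
    and sc1: "\<And>c x y. x \<in> N \<Longrightarrow> y \<in> N \<Longrightarrow> f [s c x, y] - formal_scale c (f [x, y]) \<in> null_tensors s N 3"
    and sc2: "\<And>c x y. x \<in> N \<Longrightarrow> y \<in> N \<Longrightarrow> f [x, s c y] - formal_scale c (f [x, y]) \<in> null_tensors s N 3"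
  shows "formal_extend f p \<in> null_tensors s N 3"
  using p unfolding null_tensors_def[of s N 2]
proof (induction rule: formal.span_induct)
  case base
  show "formal.subspace {p. formal_extend f p \<in> null_tensors s N 3}"
    using subspace_null_tensors[of s N 3]
    by (auto simp: formal.subspace_def formal_extend_add formal_extend_scale formal_extend_zero)
next
  case (step p)
  from step consider
      us vs x y where "p = formal_pure (us @ (x + y) # vs) - formal_pure (us @ x # vs) - formal_pure (us @ y # vs)"
        "set us \<subseteq> N" "set vs \<subseteq> N" "x \<in> N" "y \<in> N" "length us + length vs + 1 = 2"
    | us vs c x where "p = formal_pure (us @ s c x # vs) - formal_scale c (formal_pure (us @ x # vs))"
        "set us \<subseteq> N" "set vs \<subseteq> N" "x \<in> N" "length us + length vs + 1 = 2"
    unfolding multilinearity_relations_def by blast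
  then show ?case
  proof cases
    case 1
    then show ?thesis using context_length2[OF 1(6)] add1 add2
      by (auto simp: formal_extend_diff)
  next
    case 2
    then show ?thesis using context_length2[OF 2(5)] sc1 sc2
      by (auto simp: formal_extend_diff formal_extend_scale)
  qed
qed

lemma null_add3:
  assumes "a \<in> N" "b \<in> N" "x \<in> N" "y \<in> N"
  shows "formal_pure [x + y, a, b] - formal_pure [x, a, b] - formal_pure [y, a, b] \<in> null_tensors s N 3"
    and "formal_pure [a, x + y, b] - formal_pure [a, x, b] - formal_pure [a, y, b] \<in> null_tensors s N 3"
    and "formal_pure [a, b, x + y] - formal_pure [a, b, x] - formal_pure [a, b, y] \<in> null_tensors s N 3"
proof -
  have gen: "formal_pure (us @ (x + y) # vs) - formal_pure (us @ x # vs) - formal_pure (us @ y # vs)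
      \<in> null_tensors s N 3"
    if "set us \<subseteq> N" "set vs \<subseteq> N" "length us + length vs + 1 = 3" for us vs
    unfolding null_tensors_def multilinearity_relations_def
    using that assms by (intro formal.span_base UnI1) blast
  show "formal_pure [x + y, a, b] - formal_pure [x, a, b] - formal_pure [y, a, b] \<in> null_tensors s N 3"
    using gen[of "[]" "[a, b]"] assms by simp
  show "formal_pure [a, x + y, b] - formal_pure [a, x, b] - formal_pure [a, y, b] \<in> null_tensors s N 3"
    using gen[of "[a]" "[b]"] assms by simp
  show "formal_pure [a, b, x + y] - formal_pure [a, b, x] - formal_pure [a, b, y] \<in> null_tensors s N 3"
    using gen[of "[a, b]" "[]"] assms by simp
qed

lemma null_scale3:
  assumes "a \<in> N" "b \<in> N" "x \<in> N"
  shows "formal_pure [s c x, a, b] - formal_scale c (formal_pure [x, a, b]) \<in> null_tensors s N 3"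
    and "formal_pure [a, s c x, b] - formal_scale c (formal_pure [a, x, b]) \<in> null_tensors s N 3"
    and "formal_pure [a, b, s c x] - formal_scale c (formal_pure [a, b, x]) \<in> null_tensors s N 3"
proof -
  have gen: "formal_pure (us @ s c x # vs) - formal_scale c (formal_pure (us @ x # vs))
      \<in> null_tensors s N 3"
    if "set us \<subseteq> N" "set vs \<subseteq> N" "length us + length vs + 1 = 3" for us vs
    unfolding null_tensors_def multilinearity_relations_def
    using that assms by (intro formal.span_base UnI2) blast
  show "formal_pure [s c x, a, b] - formal_scale c (formal_pure [x, a, b]) \<in> null_tensors s N 3"
    using gen[of "[]" "[a, b]"] assms by simp
  show "formal_pure [a, s c x, b] - formal_scale c (formal_pure [a, x, b]) \<in> null_tensors s N 3"
    using gen[of "[a]" "[b]"] assms by simp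
  show "formal_pure [a, b, s c x] - formal_scale c (formal_pure [a, b, x]) \<in> null_tensors s N 3"
    using gen[of "[a, b]" "[]"] assms by simp
qed

lemma formal_flip_null:
  fixes s :: "'k::field \<Rightarrow> 'n::ab_group_add \<Rightarrow> 'n"
  assumes "p \<in> null_tensors s N 2"
  shows "formal_flip p \<in> null_tensors s N 2"
  using assms unfolding null_tensors_def
proof (induction rule: formal.span_induct)
  have lookup: "Poly_Mapping.lookup (formal_flip q) k = Poly_Mapping.lookup q (rev k)"
    for q :: "'n list \<Rightarrow>\<^sub>0 'k" and k
    by (simp add: formal_flip_def map_key.rep_eq)
  have add: "formal_flip (q + q') = formal_flip q + formal_flip q'"
    and diff: "formal_flip (q - q') = formal_flip q - formal_flip q'"
    and scale: "formal_flip (formal_scale c q) = formal_scale c (formal_flip q)"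
    and zero: "formal_flip (0 :: 'n list \<Rightarrow>\<^sub>0 'k) = 0"
    for q q' :: "'n list \<Rightarrow>\<^sub>0 'k" and c
    by (auto intro!: poly_mapping_eqI simp: lookup lookup_add lookup_minus)
  let ?M = "formal.span (multilinearity_relations s N 2)"
  {
    case base
    show "formal.subspace {p. formal_flip p \<in> ?M}"
      by (auto simp: formal.subspace_def add scale zero formal.span_add formal.span_scale formal.span_zero)
  next
    case (step p)
    have gen_add: "formal_pure (us @ (x + y) # vs) - formal_pure (us @ x # vs) - formal_pure (us @ y # vs) \<in> ?M"
      if "set us \<subseteq> N" "set vs \<subseteq> N" "x \<in> N" "y \<in> N" "length us + length vs + 1 = 2" for us vs x y
      unfolding multilinearity_relations_def
      using that by (intro formal.span_base UnI1) blast
    have gen_scale: "formal_pure (us @ s c x # vs) - formal_scale c (formal_pure (us @ x # vs)) \<in> ?M"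
      if "set us \<subseteq> N" "set vs \<subseteq> N" "x \<in> N" "length us + length vs + 1 = 2" for us vs c x
      unfolding multilinearity_relations_def
      using that by (intro formal.span_base UnI2) blast
    from step consider
        us vs x y where "p = formal_pure (us @ (x + y) # vs) - formal_pure (us @ x # vs) - formal_pure (us @ y # vs)"
          "set us \<subseteq> N" "set vs \<subseteq> N" "x \<in> N" "y \<in> N" "length us + length vs + 1 = 2"
      | us vs c x where "p = formal_pure (us @ s c x # vs) - formal_scale c (formal_pure (us @ x # vs))"
          "set us \<subseteq> N" "set vs \<subseteq> N" "x \<in> N" "length us + length vs + 1 = 2"
      unfolding multilinearity_relations_def by blast
    then show ?case
    proof cases
      case 1
      then show ?thesis
        using context_length2[OF 1(6)] gen_add[of vs us x y]
        by (auto simp: diff formal_flip_pure)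
    next
      case 2
      then show ?thesis
        using context_length2[OF 2(5)] gen_scale[of vs us x c]
        by (auto simp: diff scale formal_flip_pure)
    qed
  }
qed

definition nybe_cross :: "('n \<Rightarrow> 'n \<Rightarrow> 'n::ab_group_add) \<Rightarrow> 'n list \<Rightarrow> 'n list \<Rightarrow> ('n list \<Rightarrow>\<^sub>0 'k::field)" where
  "nybe_cross mul p q =
       formal_pure [p ! 0, q ! 0, mul (p ! 1) (q ! 1)]
     + formal_pure [p ! 0, mul (p ! 1) (q ! 0) + mul (q ! 0) (p ! 1), q ! 1]
     + formal_pure [mul (p ! 0) (q ! 0), q ! 1, p ! 1]"

context novikov_algebra
begin

lemma carrier_closed: "x \<in> A \<Longrightarrow> y \<in> A \<Longrightarrow> x + y \<in> A" "x \<in> A \<Longrightarrow> s c x \<in> A"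
  using subspace_carrier by (auto simp: subspace_add subspace_scale)

lemma null_sum3:
  assumes "p - q - r \<in> null_tensors s A 3" "p' - q' - r' \<in> null_tensors s A 3"
    "p'' - q'' - r'' \<in> null_tensors s A 3"
  shows "(p + p' + p'') - (q + q' + q'') - (r + r' + r'') \<in> null_tensors s A 3"
  using formal.subspace_add[OF subspace_null_tensors
      formal.subspace_add[OF subspace_null_tensors assms(1,2)] assms(3)]
  by (simp add: algebra_simps)

lemma null_sum3_scale:
  assumes "p - formal_scale c q \<in> null_tensors s A 3" "p' - formal_scale c q' \<in> null_tensors s A 3"
    "p'' - formal_scale c q'' \<in> null_tensors s A 3"
  shows "(p + p' + p'') - formal_scale c (q + q' + q'') \<in> null_tensors s A 3"
  using formal.subspace_add[OF subspace_null_tensors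
      formal.subspace_add[OF subspace_null_tensors assms(1,2)] assms(3)]
  by (simp add: algebra_simps formal.scale_right_distrib)

lemma null_add3_eq:
  assumes "z = x + y" "a \<in> A" "b \<in> A" "x \<in> A" "y \<in> A"
  shows "formal_pure [z, a, b] - formal_pure [x, a, b] - formal_pure [y, a, b] \<in> null_tensors s A 3"
    and "formal_pure [a, z, b] - formal_pure [a, x, b] - formal_pure [a, y, b] \<in> null_tensors s A 3"
    and "formal_pure [a, b, z] - formal_pure [a, b, x] - formal_pure [a, b, y] \<in> null_tensors s A 3"
  unfolding assms(1) using assms(2-) by (auto intro!: null_add3)

lemma null_scale3_eq:
  assumes "z = s c x" "a \<in> A" "b \<in> A" "x \<in> A"
  shows "formal_pure [z, a, b] - formal_scale c (formal_pure [x, a, b]) \<in> null_tensors s A 3"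
    and "formal_pure [a, z, b] - formal_scale c (formal_pure [a, x, b]) \<in> null_tensors s A 3"
    and "formal_pure [a, b, z] - formal_scale c (formal_pure [a, b, x]) \<in> null_tensors s A 3"
  unfolding assms(1) using assms(2-) by (auto intro!: null_scale3)

lemma nybe_cross_null_right:
  assumes "p \<in> null_tensors s A 2" "u \<in> A" "w \<in> A"
  shows "formal_extend (nybe_cross mul [u, w]) p \<in> null_tensors s A 3"
  using assms(2,3)
  by (intro formal_extend_null[OF assms(1)];
      simp only: nybe_cross_def nth_Cons_0 nth_Cons_Suc One_nat_def;
      intro null_sum3 null_sum3_scale null_add3_eq null_scale3_eq;
      simp add: mul_add_left mul_add_right mul_scale_left mul_scale_right mul_closed
        carrier_closed scale_right_distrib)

lemma nybe_cross_null_left: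
  assumes "p \<in> null_tensors s A 2" "u \<in> A" "w \<in> A"
  shows "formal_extend (\<lambda>k. nybe_cross mul k [u, w]) p \<in> null_tensors s A 3"
  using assms(2,3)
  by (intro formal_extend_null[OF assms(1)];
      simp only: nybe_cross_def nth_Cons_0 nth_Cons_Suc One_nat_def;
      intro null_sum3 null_sum3_scale null_add3_eq null_scale3_eq;
      simp add: mul_add_left mul_add_right mul_scale_left mul_scale_right mul_closed
        carrier_closed scale_right_distrib)

lemma nybe_expression_null_diff:
  assumes xy: "\<And>\<alpha>. \<alpha> < n \<Longrightarrow> x \<alpha> \<in> A \<and> y \<alpha> \<in> A"
    and xy': "\<And>\<alpha>. \<alpha> < m \<Longrightarrow> x' \<alpha> \<in> A \<and> y' \<alpha> \<in> A"
    and D: "(\<Sum>\<alpha><n. formal_pure [x \<alpha>, y \<alpha>]) - (\<Sum>\<alpha><m. formal_pure [x' \<alpha>, y' \<alpha>]) \<in> null_tensors s A 2"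
      (is "?D \<in> _")
  shows "nybe_expression mul n x y - nybe_expression mul m x' y' \<in> null_tensors s A 3"
proof -
  have "nybe_expression mul n x y - nybe_expression mul m x' y' =
      (\<Sum>\<alpha><n. formal_extend (nybe_cross mul [x \<alpha>, y \<alpha>]) ?D) +
      (\<Sum>\<beta><m. formal_extend (\<lambda>k. nybe_cross mul k [x' \<beta>, y' \<beta>]) ?D)"
  proof -
    have 1: "nybe_expression mul n x y = (\<Sum>\<alpha><n. \<Sum>\<beta><n. nybe_cross mul [x \<alpha>, y \<alpha>] [x \<beta>, y \<beta>])"
      for n x y by (simp add: nybe_expression_def nybe_cross_def)
    have 2: "(\<Sum>\<alpha><n. \<Sum>\<beta><m. nybe_cross mul [x \<alpha>, y \<alpha>] [x' \<beta>, y' \<beta>]) =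
        (\<Sum>\<beta><m. \<Sum>\<alpha><n. nybe_cross mul [x \<alpha>, y \<alpha>] [x' \<beta>, y' \<beta>])"
      by (rule sum.swap)
    have 3: "(\<Sum>\<alpha><m. \<Sum>\<beta><m. nybe_cross mul [x' \<alpha>, y' \<alpha>] [x' \<beta>, y' \<beta>]) =
        (\<Sum>\<beta><m. \<Sum>\<alpha><m. nybe_cross mul [x' \<alpha>, y' \<alpha>] [x' \<beta>, y' \<beta>])"
      by (rule sum.swap)
    show ?thesis
      by (simp add: 1 2 3 formal_extend_diff formal_extend_sum sum_subtractf)
  qed
  also have "\<dots> \<in> null_tensors s A 3"
    using xy xy' D
    by (intro formal.subspace_add formal.subspace_sum subspace_null_tensors
        nybe_cross_null_left nybe_cross_null_right) auto
  finally show ?thesis .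
qed

lemma nybe_iff:
  assumes "\<And>\<alpha>. \<alpha> < n \<Longrightarrow> x \<alpha> \<in> A \<and> y \<alpha> \<in> A"
  shows "nybe s A mul (tensor_class s A 2 (\<Sum>\<alpha><n. formal_pure [x \<alpha>, y \<alpha>])) \<longleftrightarrow>
    tensor_class s A 3 (nybe_expression mul n x y) = tensor_class s A 3 0"
proof
  assume "nybe s A mul (tensor_class s A 2 (\<Sum>\<alpha><n. formal_pure [x \<alpha>, y \<alpha>]))"
  then obtain m x' y' where m: "\<And>\<alpha>. \<alpha> < m \<Longrightarrow> x' \<alpha> \<in> A \<and> y' \<alpha> \<in> A"
    "tensor_class s A 2 (\<Sum>\<alpha><n. formal_pure [x \<alpha>, y \<alpha>]) = tensor_class s A 2 (\<Sum>\<alpha><m. formal_pure [x' \<alpha>, y' \<alpha>])"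
    "tensor_class s A 3 (nybe_expression mul m x' y') = tensor_class s A 3 0"
    unfolding nybe_def by blast
  then have "tensor_class s A 3 (nybe_expression mul n x y) = tensor_class s A 3 (nybe_expression mul m x' y')"
    unfolding tensor_class_eq_iff using assms by (intro nybe_expression_null_diff) auto
  with m(3) show "tensor_class s A 3 (nybe_expression mul n x y) = tensor_class s A 3 0"
    by simp
qed (use assms in \<open>auto simp: nybe_def\<close>)

end

end

theory Submission
  imports Defs
begin

text \<open>
  Let \<open>O(u, v) = T u \<circ> T v - T (l (T u) v) - T (r (T v) u)\<close> be the defect of \<open>T\<close>, so that \<open>T\<close> is an
  O-operator precisely when \<open>O\<close> vanishes. With a basis \<open>b i\<close> of \<open>V\<close>, dual basis \<open>\<epsilon> i\<close> and
  \<open>O i j = O (b i, b j)\<close>, the Yang-Baxter expression of \<open>r = \<Sum>i. T (b i) \<otimes> \<epsilon> i - \<epsilon> i \<otimes> T (b i)\<close> is the tensor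

  \<open>\<Sum>i j. \<epsilon> i \<otimes> \<epsilon> j \<otimes> O i j + O i j \<otimes> \<epsilon> j \<otimes> \<epsilon> i - \<epsilon> i \<otimes> (O i j + O j i) \<otimes> \<epsilon> j\<close>.

  Indeed, expanding the product of the semidirect product leaves, besides the terms with
  \<open>T (b i) \<circ> T (b j)\<close>, only tensors in which \<open>\<epsilon> i \<circ> \<phi>\<close> stands in one slot and \<open>T (b i)\<close> in another,
  where \<open>\<phi>\<close> is an action operator of \<open>A\<close> on \<open>V\<close>. The canonical element \<open>\<Sum>i. \<epsilon> i \<otimes> b i\<close> lets \<open>\<phi>\<close> be moved
  from the first slot to the second (\<open>contraction_transpose\<close>), which turns these tensors into the
  terms \<open>T (l (T u) v)\<close> and \<open>T (r (T v) u)\<close> of the defect (\<open>nybe_term_total\<close>). The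
  actions on the dual space are \<open>l* + r*\<close> and \<open>- r*\<close>, so in the sum of a product of an algebra element
  with a dual vector and the opposite product only \<open>l*\<close> survives.

  The formula shows at once that the equation holds when \<open>O = 0\<close>. Conversely, its first summand is
  the only one in \<open>V* \<otimes> V* \<otimes> A\<close>, so evaluating the first two factors at \<open>u\<close> and \<open>v\<close> recovers
  \<open>O(u, v)\<close> (\<open>nybe_expression_null_iff\<close>).

  All calculations with tensors are carried out on scalars: a formal sum represents the zero tensor
  if and only if every multilinear form kills it (\<open>null_tensors_iff_multilinear\<close>), because a
  linear functional separates a vector from a subspace not containing it. The expression thus needs
  to be computed only under an arbitrary trilinear form \<open>\<tau>\<close>.
\<close>

section \<open>Multilinear forms detect null tensors\<close>

definition multilinear_form ::
    "('k::field \<Rightarrow> 'n::ab_group_add \<Rightarrow> 'n) \<Rightarrow> 'n set \<Rightarrow> nat \<Rightarrow> ('n list \<Rightarrow> 'k) \<Rightarrow> bool" where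
  "multilinear_form s N n f \<longleftrightarrow>
     (\<forall>us vs x y. set us \<subseteq> N \<longrightarrow> set vs \<subseteq> N \<longrightarrow> x \<in> N \<longrightarrow> y \<in> N \<longrightarrow>
        length us + length vs + 1 = n \<longrightarrow>
        f (us @ (x + y) # vs) = f (us @ x # vs) + f (us @ y # vs)) \<and>
     (\<forall>us vs c x. set us \<subseteq> N \<longrightarrow> set vs \<subseteq> N \<longrightarrow> x \<in> N \<longrightarrow>
        length us + length vs + 1 = n \<longrightarrow>
        f (us @ s c x # vs) = c * f (us @ x # vs))"

lemma vector_space_field: "vector_space ((*) :: 'k::field \<Rightarrow> 'k \<Rightarrow> 'k)"
  by unfold_locales (auto simp: algebra_simps)

lemma formal_pair: "vector_space_pair formal_scale ((*) :: 'k::field \<Rightarrow> 'k \<Rightarrow> 'k)"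
  by (intro vector_space_pair.intro formal.vector_space_axioms vector_space_field)

lemma linear_functional_iff:
  fixes s :: "'k::field \<Rightarrow> 'v::ab_group_add \<Rightarrow> 'v"
  assumes "vector_space s"
  shows "Vector_Spaces.linear s (*) f \<longleftrightarrow>
    (\<forall>v w. f (v + w) = f v + f w) \<and> (\<forall>k v. f (s k v) = k * f v)"
  using assms vector_space_field
  by (auto simp: Vector_Spaces.linear_def module_hom_def module_hom_axioms_def
      module_iff_vector_space)

text \<open>
  The extension is obtained from \<^const>\<open>formal_extend\<close> with values in the formal sums over the
  one-element type, which is a copy of the field.
\<close>

lemma formal_linear_extension:
  fixes f :: "'n list \<Rightarrow> 'k::field"
  shows "\<exists>\<Phi>. Vector_Spaces.linear formal_scale (*) \<Phi> \<and> (\<forall>xs. \<Phi> (formal_pure xs) = f xs)"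
proof (intro exI conjI allI)
  let ?\<Phi> = "\<lambda>p. Poly_Mapping.lookup (formal_extend (\<lambda>xs. Poly_Mapping.single () (f xs)) p) ()"
  show "Vector_Spaces.linear formal_scale (*) ?\<Phi>"
    by (simp add: linear_functional_iff[OF formal.vector_space_axioms]
        formal_extend_add formal_extend_scale lookup_add)
  show "?\<Phi> (formal_pure xs) = f xs" for xs
    by simp
qed

text \<open>
  A basis of the span stays independent when \<open>p\<close> is added to it, so a functional may be prescribed
  as 0 on that basis and 1 on \<open>p\<close>.
\<close>

lemma separating_functional:
  fixes s :: "'k::field \<Rightarrow> 'v::ab_group_add \<Rightarrow> 'v"
  assumes vs: "vector_space s" and p: "p \<notin> module.span s S"
  obtains \<Phi> where "Vector_Spaces.linear s (*) \<Phi>"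
    "\<And>q. q \<in> module.span s S \<Longrightarrow> \<Phi> q = 0" "\<Phi> p \<noteq> 0"
proof -
  interpret P: vector_space_pair s "(*) :: 'k \<Rightarrow> 'k \<Rightarrow> 'k"
    by (intro vector_space_pair.intro vs vector_space_field)
  obtain B where B: "B \<subseteq> S" "P.vs1.independent B" "P.vs1.span B = P.vs1.span S"
    using P.vs1.maximal_independent_subset[of S]
    by (metis P.vs1.span_minimal P.vs1.span_mono P.vs1.subspace_span subset_antisym)
  have "P.vs1.independent (insert p B)"
    using B p by (simp add: P.vs1.independent_insert)
  then obtain \<Phi> where \<Phi>: "Vector_Spaces.linear s (*) \<Phi>"
      "\<forall>q\<in>insert p B. \<Phi> q = (if q = p then 1 else 0)"
    using P.linear_independent_extend[where f = "\<lambda>q. if q = p then 1 else 0"] by metis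
  have "p \<notin> B" using p B P.vs1.span_base by blast
  then have "\<Phi> q = 0" if "q \<in> B" for q
    using \<Phi>(2) that by auto
  then have "\<Phi> q = 0" if "q \<in> P.vs1.span S" for q
    using P.linear_eq_0_on_span[OF \<Phi>(1), of B q] that B(3) by auto
  with \<Phi> show thesis by (intro that[of \<Phi>]) auto
qed

text \<open>
  This is the universal property of the tensor power, in the form of a test on scalars: functionals on
  formal sums that kill the multilinearity relations are the same thing as multilinear forms.
\<close>

lemma null_tensors_iff_multilinear:
  "p \<in> null_tensors s N n \<longleftrightarrow>
    (\<forall>\<Phi>. Vector_Spaces.linear formal_scale (*) \<Phi> \<longrightarrow>
      multilinear_form s N n (\<lambda>xs. \<Phi> (formal_pure xs)) \<longrightarrow> \<Phi> p = 0)"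
proof (intro iffI allI impI)
  fix \<Phi>
  assume p: "p \<in> null_tensors s N n" and lin: "Vector_Spaces.linear formal_scale (*) \<Phi>"
    and ml: "multilinear_form s N n (\<lambda>xs. \<Phi> (formal_pure xs))"
  interpret \<Phi>: Vector_Spaces.linear formal_scale "(*)" \<Phi> by (rule lin)
  have "\<Phi> q = 0" if "q \<in> multilinearity_relations s N n" for q
    using that ml unfolding multilinearity_relations_def multilinear_form_def
    by (auto simp: \<Phi>.diff \<Phi>.scale)
  then show "\<Phi> p = 0"
    using p unfolding null_tensors_def
    by (rule vector_space_pair.linear_eq_0_on_span[OF formal_pair lin])
next
  assume a: "\<forall>\<Phi>. Vector_Spaces.linear formal_scale (*) \<Phi> \<longrightarrow>
      multilinear_form s N n (\<lambda>xs. \<Phi> (formal_pure xs)) \<longrightarrow> \<Phi> p = 0"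
  show "p \<in> null_tensors s N n"
  proof (rule ccontr)
    assume "p \<notin> null_tensors s N n"
    then obtain \<Phi> where lin: "Vector_Spaces.linear formal_scale (*) \<Phi>"
      and z: "\<And>q. q \<in> null_tensors s N n \<Longrightarrow> \<Phi> q = 0" and p: "\<Phi> p \<noteq> 0"
      unfolding null_tensors_def
      using separating_functional[OF formal.vector_space_axioms] by metis
    interpret \<Phi>: Vector_Spaces.linear formal_scale "(*)" \<Phi> by (rule lin)
    have rel: "\<Phi> q = 0" if "q \<in> multilinearity_relations s N n" for q
      using z that by (simp add: null_tensors_def formal.span_base)
    have "multilinear_form s N n (\<lambda>xs. \<Phi> (formal_pure xs))"
      unfolding multilinear_form_def
    proof (intro conjI allI impI)
      fix us vs x y
      assume h: "set us \<subseteq> N" "set vs \<subseteq> N" "x \<in> N" "y \<in> N" "length us + length vs + 1 = n"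
      then have "formal_pure (us @ (x + y) # vs) - formal_pure (us @ x # vs)
          - formal_pure (us @ y # vs) \<in> multilinearity_relations s N n"
        unfolding multilinearity_relations_def by blast
      from rel[OF this] show "\<Phi> (formal_pure (us @ (x + y) # vs)) =
          \<Phi> (formal_pure (us @ x # vs)) + \<Phi> (formal_pure (us @ y # vs))"
        by (simp add: \<Phi>.diff diff_eq_eq)
    next
      fix us vs c x
      assume h: "set us \<subseteq> N" "set vs \<subseteq> N" "x \<in> N" "length us + length vs + 1 = n"
      then have "formal_pure (us @ s c x # vs) - formal_scale c (formal_pure (us @ x # vs))
          \<in> multilinearity_relations s N n"
        unfolding multilinearity_relations_def by blast
      from rel[OF this] show "\<Phi> (formal_pure (us @ s c x # vs)) = c * \<Phi> (formal_pure (us @ x # vs))"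
        by (simp add: \<Phi>.diff \<Phi>.scale)
    qed
    with a lin p show False by blast
  qed
qed

text \<open>
  Multilinear forms of order three as functions of three arguments, which spares the calculations
  below the case distinction on the position of a slot within a list.
\<close>

locale trilinear_form =
  fixes s :: "'k::field \<Rightarrow> 'n::ab_group_add \<Rightarrow> 'n" and N :: "'n set" and \<tau> :: "'n \<Rightarrow> 'n \<Rightarrow> 'n \<Rightarrow> 'k"
  assumes add: "x \<in> N \<Longrightarrow> x' \<in> N \<Longrightarrow> y \<in> N \<Longrightarrow> z \<in> N \<Longrightarrow> \<tau> (x + x') y z = \<tau> x y z + \<tau> x' y z"
      "x \<in> N \<Longrightarrow> x' \<in> N \<Longrightarrow> y \<in> N \<Longrightarrow> z \<in> N \<Longrightarrow> \<tau> y (x + x') z = \<tau> y x z + \<tau> y x' z"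
      "x \<in> N \<Longrightarrow> x' \<in> N \<Longrightarrow> y \<in> N \<Longrightarrow> z \<in> N \<Longrightarrow> \<tau> y z (x + x') = \<tau> y z x + \<tau> y z x'"
    and scale: "x \<in> N \<Longrightarrow> y \<in> N \<Longrightarrow> z \<in> N \<Longrightarrow> \<tau> (s c x) y z = c * \<tau> x y z"
      "x \<in> N \<Longrightarrow> y \<in> N \<Longrightarrow> z \<in> N \<Longrightarrow> \<tau> y (s c x) z = c * \<tau> y x z"
      "x \<in> N \<Longrightarrow> y \<in> N \<Longrightarrow> z \<in> N \<Longrightarrow> \<tau> y z (s c x) = c * \<tau> y z x"

lemma context_length3:
  assumes "length us + length vs + 1 = 3"
  shows "(\<exists>w z. us = [w, z] \<and> vs = []) \<or> (\<exists>w z. us = [w] \<and> vs = [z]) \<or> (\<exists>w z. us = [] \<and> vs = [w, z])"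
proof -
  from assms consider "length us = 2" "length vs = 0" | "length us = 1" "length vs = 1"
    | "length us = 0" "length vs = 2" by linarith
  then show ?thesis
    by cases (auto simp: length_Suc_conv numeral_2_eq_2)
qed

lemma multilinear_form_3_iff:
  "multilinear_form s N 3 f \<longleftrightarrow> trilinear_form s N (\<lambda>x y z. f [x, y, z])"
proof
  assume f: "multilinear_form s N 3 f"
  have a: "f (us @ (x + y) # vs) = f (us @ x # vs) + f (us @ y # vs)"
    if "set us \<subseteq> N" "set vs \<subseteq> N" "x \<in> N" "y \<in> N" "length us + length vs + 1 = 3" for us vs x y
    using f that unfolding multilinear_form_def by blast
  have s: "f (us @ s c x # vs) = c * f (us @ x # vs)"
    if "set us \<subseteq> N" "set vs \<subseteq> N" "x \<in> N" "length us + length vs + 1 = 3" for us vs c x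
    using f that unfolding multilinear_form_def by blast
  show "trilinear_form s N (\<lambda>x y z. f [x, y, z])"
    using a[of "[]" "[_, _]"] a[of "[_]" "[_]"] a[of "[_, _]" "[]"]
      s[of "[]" "[_, _]"] s[of "[_]" "[_]"] s[of "[_, _]" "[]"]
    by unfold_locales auto
next
  assume "trilinear_form s N (\<lambda>x y z. f [x, y, z])"
  then interpret trilinear_form s N "\<lambda>x y z. f [x, y, z]" .
  show "multilinear_form s N 3 f"
    unfolding multilinear_form_def
  proof (intro conjI allI impI)
    fix us vs x y
    assume "set us \<subseteq> N" "set vs \<subseteq> N" "x \<in> N" "y \<in> N" and n: "length us + length vs + 1 = 3"
    with context_length3[OF n]
    show "f (us @ (x + y) # vs) = f (us @ x # vs) + f (us @ y # vs)"
      by (auto simp: add)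
  next
    fix us vs c x
    assume "set us \<subseteq> N" "set vs \<subseteq> N" "x \<in> N" and n: "length us + length vs + 1 = 3"
    with context_length3[OF n]
    show "f (us @ s c x # vs) = c * f (us @ x # vs)"
      by (auto simp: scale)
  qed
qed

section \<open>Dual bases\<close>

lemma sum_lessThan_add:
  fixes h :: "nat \<Rightarrow> 'b::comm_monoid_add"
  shows "(\<Sum>i<n + k. h i) = (\<Sum>i<n. h i) + (\<Sum>i<k. h (n + i))"
  by (induction k) (simp_all add: add.assoc)

text \<open>
  A basis enters the argument only through the expansion of vectors with linear coordinates. It is
  enumerated by numbers below \<open>m\<close> because presentations of tensors are indexed in this way.
\<close>

locale dual_frame = vector_space t
  for t :: "'k::field \<Rightarrow> 'v::ab_group_add \<Rightarrow> 'v" +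
  fixes m :: nat and b :: "nat \<Rightarrow> 'v" and \<epsilon> :: "nat \<Rightarrow> 'v \<Rightarrow> 'k"
  assumes coordinate_dual: "i < m \<Longrightarrow> \<epsilon> i \<in> dual_space t"
    and expansion: "(\<Sum>i<m. t (\<epsilon> i v) (b i)) = v"
begin

lemma dual_iff: "f \<in> dual_space t \<longleftrightarrow>
    (\<forall>v w. f (v + w) = f v + f w) \<and> (\<forall>k v. f (t k v) = k * f v)"
  by (simp add: dual_space_def linear_functional_iff vector_space_axioms)

lemma dual_add: "f \<in> dual_space t \<Longrightarrow> g \<in> dual_space t \<Longrightarrow> f + g \<in> dual_space t"
  by (auto simp: dual_iff distrib_left ac_simps)

lemma dual_scaled: "f \<in> dual_space t \<Longrightarrow> dual_scale c f \<in> dual_space t"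
  by (simp add: dual_iff dual_scale_def distrib_left mult.left_commute)

lemma additive_expansion:
  fixes h :: "'v \<Rightarrow> 'w::ab_group_add"
  assumes add: "\<And>v w. h (v + w) = h v + h w" and scale: "\<And>k v. h (t k v) = g k (h v)"
  shows "h v = (\<Sum>i<m. g (\<epsilon> i v) (h (b i)))"
proof -
  have "h 0 = 0" using add[of 0 0] by simp
  then have "h (sum f I) = (\<Sum>i\<in>I. h (f i))" for f and I :: "nat set"
    by (induction I rule: infinite_finite_induct) (simp_all add: add)
  then have "h (\<Sum>i<m. t (\<epsilon> i v) (b i)) = (\<Sum>i<m. g (\<epsilon> i v) (h (b i)))"
    by (simp add: scale)
  then show ?thesis by (simp add: expansion)
qed

text \<open>
  The dual expansion \<open>f = \<Sum>i. f (b i) \<epsilon> i\<close>, seen through a linear functional \<open>h\<close> that is defined on the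
  dual space only.
\<close>

lemma functional_sum:
  assumes add: "\<And>f g. f \<in> dual_space t \<Longrightarrow> g \<in> dual_space t \<Longrightarrow> h (f + g) = h f + h g"
    and scale: "\<And>c f. f \<in> dual_space t \<Longrightarrow> h (dual_scale c f) = c * h f"
    and f: "f \<in> dual_space t"
  shows "h f = (\<Sum>i<m. f (b i) * h (\<epsilon> i))"
proof -
  have "dual_scale 0 f = 0" by (auto simp: dual_scale_def)
  then have h0: "h 0 = 0" using scale[OF f, of 0] by simp
  have zero: "0 \<in> dual_space t" by (simp add: dual_iff)
  have sum: "sum g I \<in> dual_space t \<and> h (sum g I) = (\<Sum>i\<in>I. h (g i))"
    if "\<And>i. i \<in> I \<Longrightarrow> g i \<in> dual_space t" for g and I :: "nat set"
    using that
  proof (induction I rule: infinite_finite_induct)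
    case (insert i I)
    then have "g i \<in> dual_space t" "sum g I \<in> dual_space t"
        "h (sum g I) = (\<Sum>i\<in>I. h (g i))" by blast+
    then show ?case
      using insert.hyps add dual_add by (simp del: plus_fun_apply)
  qed (simp_all add: h0 zero del: zero_fun_apply)
  have ap: "(\<Sum>i\<in>I. g i) v = (\<Sum>i\<in>I. g i v)" for g :: "nat \<Rightarrow> 'v \<Rightarrow> 'k" and I v
    by (induction I rule: infinite_finite_induct) auto
  have "f v = (\<Sum>i<m. \<epsilon> i v * f (b i))" for v
    by (rule additive_expansion) (use f in \<open>auto simp: dual_iff\<close>)
  from this[symmetric] have "(\<Sum>i<m. dual_scale (f (b i)) (\<epsilon> i)) = f"
    by (simp add: fun_eq_iff ap dual_scale_def mult.commute)
  moreover have "h (\<Sum>i<m. dual_scale (f (b i)) (\<epsilon> i)) = (\<Sum>i<m. h (dual_scale (f (b i)) (\<epsilon> i)))"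
    by (intro conjunct2[OF sum] dual_scaled coordinate_dual) simp
  ultimately show ?thesis
    using scale coordinate_dual by simp
qed

text \<open>
  The tensor \<open>\<Sum>i. \<epsilon> i \<otimes> b i\<close> corresponds to the identity of \<open>V\<close>. Composing the identity with \<open>\<phi>\<close> on
  either side gives the same map, so \<open>\<phi>\<close> may act on the dual basis or on the basis. In coordinates both
  sides are the sum of \<open>\<epsilon> i (\<phi> (b k)) \<sigma> (\<epsilon> k, b i)\<close> over all \<open>i\<close> and \<open>k\<close>.
\<close>

lemma contraction_transpose:
  assumes \<sigma>: "\<And>f g v. f \<in> dual_space t \<Longrightarrow> g \<in> dual_space t \<Longrightarrow> \<sigma> (f + g) v = \<sigma> f v + \<sigma> g v"
      "\<And>c f v. f \<in> dual_space t \<Longrightarrow> \<sigma> (dual_scale c f) v = c * \<sigma> f v"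
      "\<And>f v w. f \<in> dual_space t \<Longrightarrow> \<sigma> f (v + w) = \<sigma> f v + \<sigma> f w"
      "\<And>c f v. f \<in> dual_space t \<Longrightarrow> \<sigma> f (t c v) = c * \<sigma> f v"
    and \<phi>: "\<And>v w. \<phi> (v + w) = \<phi> v + \<phi> w" "\<And>c v. \<phi> (t c v) = t c (\<phi> v)"
  shows "(\<Sum>i<m. \<sigma> (\<lambda>v. \<epsilon> i (\<phi> v)) (b i)) = (\<Sum>i<m. \<sigma> (\<epsilon> i) (\<phi> (b i)))"
proof -
  have d: "(\<lambda>v. \<epsilon> i (\<phi> v)) \<in> dual_space t" if "i < m" for i
    using coordinate_dual[OF that] by (simp add: dual_iff \<phi>)
  have "(\<Sum>i<m. \<sigma> (\<lambda>v. \<epsilon> i (\<phi> v)) (b i)) = (\<Sum>i<m. \<Sum>k<m. \<epsilon> i (\<phi> (b k)) * \<sigma> (\<epsilon> k) (b i))"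
    using d by (intro sum.cong refl functional_sum[of "\<lambda>f. \<sigma> f _"]) (auto simp del: plus_fun_apply simp: \<sigma>)
  also have "\<dots> = (\<Sum>k<m. \<Sum>i<m. \<epsilon> i (\<phi> (b k)) * \<sigma> (\<epsilon> k) (b i))"
    by (rule sum.swap)
  also have "\<dots> = (\<Sum>k<m. \<sigma> (\<epsilon> k) (\<phi> (b k)))"
    using coordinate_dual
    by (intro sum.cong refl additive_expansion[of "\<sigma> _" "(*)", symmetric]) (auto simp: \<sigma>)
  finally show ?thesis .
qed

end

section \<open>The defect of T and the Yang-Baxter expression in coordinates\<close>

locale framed_representation =
  novikov_representation s UNIV mul t UNIV l r + dual_frame t m b \<epsilon>
  for s :: "'k::field \<Rightarrow> 'a::ab_group_add \<Rightarrow> 'a" and mul :: "'a \<Rightarrow> 'a \<Rightarrow> 'a"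
    and t :: "'k \<Rightarrow> 'v::ab_group_add \<Rightarrow> 'v" and l r :: "'a \<Rightarrow> 'v \<Rightarrow> 'v"
    and m :: nat and b :: "nat \<Rightarrow> 'v" and \<epsilon> :: "nat \<Rightarrow> 'v \<Rightarrow> 'k" +
  fixes T :: "'v \<Rightarrow> 'a"
  assumes T_linear: "Vector_Spaces.linear t s T"
begin

sublocale T: Vector_Spaces.linear t s T by (rule T_linear)

abbreviation carrier :: "('a \<times> ('v \<Rightarrow> 'k)) set" where
  "carrier \<equiv> UNIV \<times> dual_space t"

abbreviation scl :: "'k \<Rightarrow> 'a \<times> ('v \<Rightarrow> 'k) \<Rightarrow> 'a \<times> ('v \<Rightarrow> 'k)" where
  "scl \<equiv> sum_scale s dual_scale"

abbreviation prd :: "'a \<times> ('v \<Rightarrow> 'k) \<Rightarrow> 'a \<times> ('v \<Rightarrow> 'k) \<Rightarrow> 'a \<times> ('v \<Rightarrow> 'k)" where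
  "prd \<equiv> semidirect_mul mul (dual_action l + dual_action r) (- dual_action r)"

definition defect :: "'v \<Rightarrow> 'v \<Rightarrow> 'a" where
  "defect u v = mul (T u) (T v) - T (l (T u) v) - T (r (T v) u)"

lemma o_operator_iff_defect: "o_operator s mul t l r T \<longleftrightarrow> (\<forall>u v. defect u v = 0)"
  by (auto simp: o_operator_def defect_def T_linear algebra_simps)

lemma zero_actions [simp]: "l 0 v = 0" "r 0 v = 0" "mul 0 a = 0" "mul a 0 = 0"
  using l_add_arg[of 0 0 v] r_add_arg[of 0 0 v] mul_add_left[of 0 0 a] mul_add_right[of a 0 0]
  by simp_all

lemma zero_dual [simp]: "0 \<in> dual_space t"
  by (simp add: dual_iff)

lemma uminus_dual: "f \<in> dual_space t \<Longrightarrow> - f \<in> dual_space t"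
  by (simp add: dual_iff)

lemma dual_comp_action:
  assumes "f \<in> dual_space t"
  shows "(\<lambda>v. f (l a v)) \<in> dual_space t" "(\<lambda>v. f (r a v)) \<in> dual_space t"
  using assms by (simp_all add: dual_iff l_add r_add l_scale r_scale)

definition in_alg :: "'a \<Rightarrow> 'a \<times> ('v \<Rightarrow> 'k)" where
  "in_alg a = (a, 0)"

definition in_dual :: "('v \<Rightarrow> 'k) \<Rightarrow> 'a \<times> ('v \<Rightarrow> 'k)" where
  "in_dual f = (0, f)"

lemma in_alg_hom: "in_alg (a + c) = in_alg a + in_alg c" "in_alg (a - c) = in_alg a - in_alg c"
    "in_alg (s k a) = scl k (in_alg a)"
  by (auto simp: in_alg_def sum_scale_def dual_scale_def fun_eq_iff)

lemma in_dual_hom: "in_dual (f + g) = in_dual f + in_dual g"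
    "in_dual (dual_scale k f) = scl k (in_dual f)"
  by (auto simp: in_dual_def sum_scale_def)

lemma carrier_mem:
  "in_alg a \<in> carrier" "f \<in> dual_space t \<Longrightarrow> in_dual f \<in> carrier"
  "x \<in> carrier \<Longrightarrow> y \<in> carrier \<Longrightarrow> x + y \<in> carrier" "x \<in> carrier \<Longrightarrow> - x \<in> carrier"
  "x \<in> carrier \<Longrightarrow> y \<in> carrier \<Longrightarrow> x - y \<in> carrier"
  using dual_add[of "snd x" "snd y"] dual_add[of "snd x" "- snd y"] uminus_dual[of "snd x"]
    uminus_dual[of "snd y"]
  by (cases x; cases y; auto simp: in_alg_def in_dual_def simp del: plus_fun_apply)+

text \<open>
  For \<open>l* + r*\<close> and \<open>- r*\<close> the signs in the definition of the dual action make
  \<open>prd (in_alg a) (in_dual g) + prd (in_dual g) (in_alg a)\<close> equal to \<open>- g \<circ> l a\<close>. The negated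
  versions are listed because one half of the skew tensor carries a sign.
\<close>

lemma prd_simps:
  assumes "f \<in> dual_space t" "g \<in> dual_space t"
  shows "prd (in_alg a) (in_alg c) = in_alg (mul a c)"
    and "prd (in_alg a) (in_dual g) = - in_dual (\<lambda>v. g (l a v)) - in_dual (\<lambda>v. g (r a v))"
    and "prd (in_alg a) (- in_dual g) = in_dual (\<lambda>v. g (l a v)) + in_dual (\<lambda>v. g (r a v))"
    and "prd (in_dual f) (in_alg c) = in_dual (\<lambda>v. f (r c v))"
    and "prd (- in_dual f) (in_alg c) = - in_dual (\<lambda>v. f (r c v))"
    and "prd (in_dual f) (in_dual g) = 0" "prd (- in_dual f) (in_dual g) = 0"
    and "prd (in_dual f) (- in_dual g) = 0" "prd (- in_dual f) (- in_dual g) = 0"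
proof -
  have "f 0 = 0" "g 0 = 0"
    using assms unfolding dual_iff by (metis add_cancel_right_right)+
  then show "prd (in_alg a) (in_alg c) = in_alg (mul a c)"
    and "prd (in_alg a) (in_dual g) = - in_dual (\<lambda>v. g (l a v)) - in_dual (\<lambda>v. g (r a v))"
    and "prd (in_alg a) (- in_dual g) = in_dual (\<lambda>v. g (l a v)) + in_dual (\<lambda>v. g (r a v))"
    and "prd (in_dual f) (in_alg c) = in_dual (\<lambda>v. f (r c v))"
    and "prd (- in_dual f) (in_alg c) = - in_dual (\<lambda>v. f (r c v))"
    and "prd (in_dual f) (in_dual g) = 0" "prd (- in_dual f) (in_dual g) = 0"
    and "prd (in_dual f) (- in_dual g) = 0" "prd (- in_dual f) (- in_dual g) = 0"
    by (auto simp: semidirect_mul_def dual_action_def fun_eq_iff zero_prod_def in_alg_def in_dual_def)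
qed

text \<open>
  The contraction in the form in which it meets the Yang-Baxter expression: \<open>\<rho>\<close> stands for a
  trilinear form with one slot filled.
\<close>

lemma pair_contraction:
  assumes \<rho>: "\<And>x y z. x \<in> carrier \<Longrightarrow> y \<in> carrier \<Longrightarrow> z \<in> carrier \<Longrightarrow> \<rho> (x + y) z = \<rho> x z + \<rho> y z"
      "\<And>c x z. x \<in> carrier \<Longrightarrow> z \<in> carrier \<Longrightarrow> \<rho> (scl c x) z = c * \<rho> x z"
      "\<And>x y z. x \<in> carrier \<Longrightarrow> y \<in> carrier \<Longrightarrow> z \<in> carrier \<Longrightarrow> \<rho> z (x + y) = \<rho> z x + \<rho> z y"
      "\<And>c x z. x \<in> carrier \<Longrightarrow> z \<in> carrier \<Longrightarrow> \<rho> z (scl c x) = c * \<rho> z x"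
    and \<phi>: "\<And>v w. \<phi> (v + w) = \<phi> v + \<phi> w" "\<And>c v. \<phi> (t c v) = t c (\<phi> v)"
  shows "(\<Sum>i<m. \<rho> (in_dual (\<lambda>v. \<epsilon> i (\<phi> v))) (in_alg (T (b i)))) =
    (\<Sum>i<m. \<rho> (in_dual (\<epsilon> i)) (in_alg (T (\<phi> (b i)))))"
  by (rule contraction_transpose[where \<sigma> = "\<lambda>f v. \<rho> (in_dual f) (in_alg (T v))", OF _ _ _ _ \<phi>])
    (simp_all only: \<rho> in_alg_hom in_dual_hom T.add T.scale carrier_mem)

text \<open>
  The legs of \<open>\<Sum>i. T (b i) \<otimes> \<epsilon> i + (- \<epsilon> i) \<otimes> T (b i)\<close>, a presentation of the skew tensor of \<open>T\<close> as a sum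
  of \<open>m + m\<close> pure tensors. Pure tensors have no coefficients, hence the sign is absorbed in the dual
  vector.
\<close>

definition left_leg :: "nat \<Rightarrow> 'a \<times> ('v \<Rightarrow> 'k)" where
  "left_leg i = (if i < m then in_alg (T (b i)) else - in_dual (\<epsilon> (i - m)))"

definition right_leg :: "nat \<Rightarrow> 'a \<times> ('v \<Rightarrow> 'k)" where
  "right_leg i = (if i < m then in_dual (\<epsilon> i) else in_alg (T (b (i - m))))"

lemma legs_carrier: "i < m + m \<Longrightarrow> left_leg i \<in> carrier \<and> right_leg i \<in> carrier"
  by (simp add: left_leg_def right_leg_def carrier_mem coordinate_dual del: mem_Sigma_iff)

end

locale framed_trilinear = framed_representation s mul t l r m b \<epsilon> T +
    \<tau>: trilinear_form "sum_scale s dual_scale" "UNIV \<times> dual_space t" \<tau>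
  for s :: "'k::field \<Rightarrow> 'a::ab_group_add \<Rightarrow> 'a" and mul :: "'a \<Rightarrow> 'a \<Rightarrow> 'a"
    and t :: "'k \<Rightarrow> 'v::ab_group_add \<Rightarrow> 'v" and l r :: "'a \<Rightarrow> 'v \<Rightarrow> 'v"
    and m :: nat and b :: "nat \<Rightarrow> 'v" and \<epsilon> :: "nat \<Rightarrow> 'v \<Rightarrow> 'k" and T :: "'v \<Rightarrow> 'a"
    and \<tau> :: "'a \<times> ('v \<Rightarrow> 'k) \<Rightarrow> 'a \<times> ('v \<Rightarrow> 'k) \<Rightarrow> 'a \<times> ('v \<Rightarrow> 'k) \<Rightarrow> 'k"
begin

definition nybe_term where
  "nybe_term x y x' y' = \<tau> x x' (prd y y') + \<tau> x (prd y x' + prd x' y) y' + \<tau> (prd x x') y' y"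

lemma scl_minus: "scl (- 1) x = - x"
  by (cases x) (auto simp: sum_scale_def dual_scale_def fun_eq_iff)

lemma \<tau>_uminus:
  assumes "x \<in> carrier" "y \<in> carrier" "z \<in> carrier"
  shows "\<tau> (- x) y z = - \<tau> x y z" "\<tau> y (- x) z = - \<tau> y x z" "\<tau> y z (- x) = - \<tau> y z x"
  using \<tau>.scale[of x y z "- 1"] assms by (simp_all add: scl_minus)

lemma \<tau>_zero:
  assumes "y \<in> carrier" "z \<in> carrier"
  shows "\<tau> 0 y z = 0" "\<tau> y 0 z = 0" "\<tau> y z 0 = 0"
proof -
  have "scl 0 0 = 0" by (auto simp: sum_scale_def dual_scale_def zero_prod_def)
  moreover have "0 \<in> carrier" by (simp add: zero_prod_def)
  ultimately show "\<tau> 0 y z = 0" "\<tau> y 0 z = 0" "\<tau> y z 0 = 0"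
    using \<tau>.scale[of 0 y z 0] assms by simp_all
qed

lemma \<tau>_diff:
  assumes "x \<in> carrier" "x' \<in> carrier" "y \<in> carrier" "z \<in> carrier"
  shows "\<tau> (x - x') y z = \<tau> x y z - \<tau> x' y z" "\<tau> y (x - x') z = \<tau> y x z - \<tau> y x' z"
    "\<tau> y z (x - x') = \<tau> y z x - \<tau> y z x'"
proof -
  have m: "- x' \<in> carrier" using assms(2) by (rule carrier_mem)
  show "\<tau> (x - x') y z = \<tau> x y z - \<tau> x' y z" "\<tau> y (x - x') z = \<tau> y x z - \<tau> y x' z"
    "\<tau> y z (x - x') = \<tau> y z x - \<tau> y z x'"
    using \<tau>.add[OF assms(1) m assms(3,4)] \<tau>_uminus[OF assms(2-4)] by simp_all
qed

text \<open>
  The four combinations of halves of the skew tensor. Products of two dual vectors vanish, and in the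
  first and last case the \<open>r\<close>-parts of the two mixed products cancel.
\<close>

lemma nybe_term_values:
  assumes f: "f \<in> dual_space t" and g: "g \<in> dual_space t"
  shows "nybe_term (in_alg a) (in_dual f) (in_alg c) (in_dual g) =
      \<tau> (in_alg (mul a c)) (in_dual g) (in_dual f)
      - \<tau> (in_alg a) (in_dual (\<lambda>v. f (l c v))) (in_dual g)"
    and "nybe_term (in_alg a) (in_dual f) (- in_dual g) (in_alg c) =
      - \<tau> (in_alg a) (in_dual g) (in_dual (\<lambda>v. f (r c v)))
      + \<tau> (in_dual (\<lambda>v. g (l a v))) (in_alg c) (in_dual f)
      + \<tau> (in_dual (\<lambda>v. g (r a v))) (in_alg c) (in_dual f)"
    and "nybe_term (- in_dual f) (in_alg a) (in_alg c) (in_dual g) =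
      \<tau> (in_dual f) (in_alg c) (in_dual (\<lambda>v. g (l a v)))
      + \<tau> (in_dual f) (in_alg c) (in_dual (\<lambda>v. g (r a v)))
      - \<tau> (in_dual f) (in_alg (mul a c)) (in_dual g)
      - \<tau> (in_dual f) (in_alg (mul c a)) (in_dual g)
      - \<tau> (in_dual (\<lambda>v. f (r c v))) (in_dual g) (in_alg a)"
    and "nybe_term (- in_dual f) (in_alg a) (- in_dual g) (in_alg c) =
      \<tau> (in_dual f) (in_dual g) (in_alg (mul a c))
      - \<tau> (in_dual f) (in_dual (\<lambda>v. g (l a v))) (in_alg c)"
  using f g
  by (simp_all add: nybe_term_def prd_simps carrier_mem dual_comp_action
      \<tau>.add \<tau>_uminus \<tau>_diff \<tau>_zero del: mem_Sigma_iff)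

text \<open>
  The central formula. Each of the eight sums with a composite \<open>\<epsilon> i \<circ> \<phi>\<close> is rewritten by a contraction
  over the index shared with the basis vector; the other index is a parameter of \<open>\<phi>\<close> and stays fixed.
\<close>

lemma nybe_term_total:
  "(\<Sum>i<m + m. \<Sum>j<m + m. nybe_term (left_leg i) (right_leg i) (left_leg j) (right_leg j)) =
    (\<Sum>i<m. \<Sum>j<m. \<tau> (in_dual (\<epsilon> i)) (in_dual (\<epsilon> j)) (in_alg (defect (b i) (b j)))
       + \<tau> (in_alg (defect (b i) (b j))) (in_dual (\<epsilon> j)) (in_dual (\<epsilon> i))
       - \<tau> (in_dual (\<epsilon> i)) (in_alg (defect (b i) (b j) + defect (b j) (b i))) (in_dual (\<epsilon> j)))"
proof -
  let ?e = "\<lambda>i. in_dual (\<epsilon> i)" and ?a = "\<lambda>v. in_alg (T v)"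
  have e: "?e i \<in> carrier" if "i < m" for i
    using coordinate_dual[OF that] by (rule carrier_mem)
  note pairs = pair_contraction[of "\<lambda>x y. \<tau> x y _"] pair_contraction[of "\<lambda>x y. \<tau> x _ y"]
      pair_contraction[of "\<lambda>x y. \<tau> y x _"] pair_contraction[of "\<lambda>x y. \<tau> _ x y"]
      pair_contraction[of "\<lambda>x y. \<tau> y _ x"] pair_contraction[of "\<lambda>x y. \<tau> _ y x"]
  have contract:
    "(\<Sum>i<m. \<tau> (in_dual (\<lambda>v. \<epsilon> i (\<phi> v))) (?a (b i)) z) = (\<Sum>i<m. \<tau> (?e i) (?a (\<phi> (b i))) z)"
    "(\<Sum>i<m. \<tau> (in_dual (\<lambda>v. \<epsilon> i (\<phi> v))) z (?a (b i))) = (\<Sum>i<m. \<tau> (?e i) z (?a (\<phi> (b i))))"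
    "(\<Sum>i<m. \<tau> (?a (b i)) (in_dual (\<lambda>v. \<epsilon> i (\<phi> v))) z) = (\<Sum>i<m. \<tau> (?a (\<phi> (b i))) (?e i) z)"
    "(\<Sum>i<m. \<tau> z (in_dual (\<lambda>v. \<epsilon> i (\<phi> v))) (?a (b i))) = (\<Sum>i<m. \<tau> z (?e i) (?a (\<phi> (b i))))"
    "(\<Sum>i<m. \<tau> (?a (b i)) z (in_dual (\<lambda>v. \<epsilon> i (\<phi> v)))) = (\<Sum>i<m. \<tau> (?a (\<phi> (b i))) z (?e i))"
    "(\<Sum>i<m. \<tau> z (?a (b i)) (in_dual (\<lambda>v. \<epsilon> i (\<phi> v)))) = (\<Sum>i<m. \<tau> z (?a (\<phi> (b i))) (?e i))"
    if z: "z \<in> carrier" and \<phi>: "\<And>v w. \<phi> (v + w) = \<phi> v + \<phi> w" "\<And>c v. \<phi> (t c v) = t c (\<phi> v)"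
    for z \<phi>
    by (rule pairs; (rule \<tau>.add \<tau>.scale z \<phi>; (assumption | rule z)))+
  note act = l_add[OF UNIV_I UNIV_I UNIV_I] l_scale[OF UNIV_I UNIV_I]
    r_add[OF UNIV_I UNIV_I UNIV_I] r_scale[OF UNIV_I UNIV_I]
  have "(\<Sum>i<m + m. \<Sum>j<m + m. nybe_term (left_leg i) (right_leg i) (left_leg j) (right_leg j)) =
    (\<Sum>i<m. \<Sum>j<m. nybe_term (?a (b i)) (?e i) (?a (b j)) (?e j)
       + nybe_term (?a (b i)) (?e i) (- ?e j) (?a (b j))
       + nybe_term (- ?e i) (?a (b i)) (?a (b j)) (?e j)
       + nybe_term (- ?e i) (?a (b i)) (- ?e j) (?a (b j)))"
    by (simp add: sum_lessThan_add left_leg_def right_leg_def sum.distrib add.assoc)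
  also have "\<dots> = (\<Sum>i<m. \<Sum>j<m.
      \<tau> (in_alg (mul (T (b i)) (T (b j)))) (?e j) (?e i)
      - \<tau> (?a (b i)) (in_dual (\<lambda>v. \<epsilon> i (l (T (b j)) v))) (?e j)
      - \<tau> (?a (b i)) (?e j) (in_dual (\<lambda>v. \<epsilon> i (r (T (b j)) v)))
      + \<tau> (in_dual (\<lambda>v. \<epsilon> j (l (T (b i)) v))) (?a (b j)) (?e i)
      + \<tau> (in_dual (\<lambda>v. \<epsilon> j (r (T (b i)) v))) (?a (b j)) (?e i)
      + \<tau> (?e i) (?a (b j)) (in_dual (\<lambda>v. \<epsilon> j (l (T (b i)) v)))
      + \<tau> (?e i) (?a (b j)) (in_dual (\<lambda>v. \<epsilon> j (r (T (b i)) v)))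
      - \<tau> (?e i) (in_alg (mul (T (b i)) (T (b j)))) (?e j)
      - \<tau> (?e i) (in_alg (mul (T (b j)) (T (b i)))) (?e j)
      - \<tau> (in_dual (\<lambda>v. \<epsilon> i (r (T (b j)) v))) (?e j) (?a (b i))
      + \<tau> (?e i) (?e j) (in_alg (mul (T (b i)) (T (b j))))
      - \<tau> (?e i) (in_dual (\<lambda>v. \<epsilon> j (l (T (b i)) v))) (?a (b j)))"
    by (intro sum.cong refl) (simp add: nybe_term_values coordinate_dual)
  also have "\<dots> = (\<Sum>i<m. \<Sum>j<m.
      \<tau> (in_alg (mul (T (b i)) (T (b j)))) (?e j) (?e i)
      - \<tau> (?a (l (T (b i)) (b j))) (?e j) (?e i)
      - \<tau> (?a (r (T (b j)) (b i))) (?e j) (?e i)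
      + \<tau> (?e i) (?a (l (T (b j)) (b i))) (?e j)
      + \<tau> (?e i) (?a (r (T (b j)) (b i))) (?e j)
      + \<tau> (?e i) (?a (l (T (b i)) (b j))) (?e j)
      + \<tau> (?e i) (?a (r (T (b i)) (b j))) (?e j)
      - \<tau> (?e i) (in_alg (mul (T (b i)) (T (b j)))) (?e j)
      - \<tau> (?e i) (in_alg (mul (T (b j)) (T (b i)))) (?e j)
      - \<tau> (?e i) (?e j) (?a (r (T (b j)) (b i)))
      + \<tau> (?e i) (?e j) (in_alg (mul (T (b i)) (T (b j))))
      - \<tau> (?e i) (?e j) (?a (l (T (b i)) (b j))))"
  proof -
    \<comment> \<open>the contraction runs over the first index, or its result appears with the two indices exchanged\<close>
    have swapped: "(\<Sum>i<m. \<Sum>j<m. p i j) = (\<Sum>i<m. \<Sum>j<m. q i j)"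
      if "\<And>j. j < m \<Longrightarrow> (\<Sum>i<m. p i j) = (\<Sum>i<m. q i j)" for p q :: "nat \<Rightarrow> nat \<Rightarrow> 'k"
      using that by (simp add: sum.swap[of p] sum.swap[of q])
    have transposed: "(\<Sum>i<m. \<Sum>j<m. p i j) = (\<Sum>i<m. \<Sum>j<m. q j i)"
      if "\<And>i. i < m \<Longrightarrow> (\<Sum>j<m. p i j) = (\<Sum>j<m. q i j)" for p q :: "nat \<Rightarrow> nat \<Rightarrow> 'k"
      using that sum.swap[of q] by simp
    have 1: "(\<Sum>i<m. \<Sum>j<m. \<tau> (?a (b i)) (in_dual (\<lambda>v. \<epsilon> i (l (T (b j)) v))) (?e j)) =
        (\<Sum>i<m. \<Sum>j<m. \<tau> (?a (l (T (b i)) (b j))) (?e j) (?e i))"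
      by (subst sum.swap, intro sum.cong refl contract e act) simp
    have 2: "(\<Sum>i<m. \<Sum>j<m. \<tau> (?a (b i)) (?e j) (in_dual (\<lambda>v. \<epsilon> i (r (T (b j)) v)))) =
        (\<Sum>i<m. \<Sum>j<m. \<tau> (?a (r (T (b j)) (b i))) (?e j) (?e i))"
      by (intro swapped contract e act)
    have 3: "(\<Sum>i<m. \<Sum>j<m. \<tau> (in_dual (\<lambda>v. \<epsilon> j (l (T (b i)) v))) (?a (b j)) (?e i)) =
        (\<Sum>i<m. \<Sum>j<m. \<tau> (?e i) (?a (l (T (b j)) (b i))) (?e j))"
      by (intro transposed contract e act)
    have 4: "(\<Sum>i<m. \<Sum>j<m. \<tau> (in_dual (\<lambda>v. \<epsilon> j (r (T (b i)) v))) (?a (b j)) (?e i)) =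
        (\<Sum>i<m. \<Sum>j<m. \<tau> (?e i) (?a (r (T (b j)) (b i))) (?e j))"
      by (intro transposed contract e act)
    have 5: "(\<Sum>i<m. \<Sum>j<m. \<tau> (?e i) (?a (b j)) (in_dual (\<lambda>v. \<epsilon> j (l (T (b i)) v)))) =
        (\<Sum>i<m. \<Sum>j<m. \<tau> (?e i) (?a (l (T (b i)) (b j))) (?e j))"
      by (intro sum.cong refl contract e act) simp
    have 6: "(\<Sum>i<m. \<Sum>j<m. \<tau> (?e i) (?a (b j)) (in_dual (\<lambda>v. \<epsilon> j (r (T (b i)) v)))) =
        (\<Sum>i<m. \<Sum>j<m. \<tau> (?e i) (?a (r (T (b i)) (b j))) (?e j))"
      by (intro sum.cong refl contract e act) simp
    have 7: "(\<Sum>i<m. \<Sum>j<m. \<tau> (in_dual (\<lambda>v. \<epsilon> i (r (T (b j)) v))) (?e j) (?a (b i))) =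
        (\<Sum>i<m. \<Sum>j<m. \<tau> (?e i) (?e j) (?a (r (T (b j)) (b i))))"
      by (intro swapped contract e act)
    have 8: "(\<Sum>i<m. \<Sum>j<m. \<tau> (?e i) (in_dual (\<lambda>v. \<epsilon> j (l (T (b i)) v))) (?a (b j))) =
        (\<Sum>i<m. \<Sum>j<m. \<tau> (?e i) (?e j) (?a (l (T (b i)) (b j))))"
      by (intro sum.cong refl contract e act) simp
    show ?thesis
      by (simp only: sum.distrib sum_subtractf 1 2 3 4 5 6 7 8)
  qed
  also have "\<dots> = (\<Sum>i<m. \<Sum>j<m. \<tau> (?e i) (?e j) (in_alg (defect (b i) (b j)))
       + \<tau> (in_alg (defect (b i) (b j))) (?e j) (?e i)
       - \<tau> (?e i) (in_alg (defect (b i) (b j) + defect (b j) (b i))) (?e j))"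
    by (intro sum.cong refl)
      (simp add: defect_def in_alg_hom \<tau>_diff \<tau>.add carrier_mem coordinate_dual del: mem_Sigma_iff)
  finally show ?thesis .
qed

end

section \<open>The Yang-Baxter equation and vanishing of the defect\<close>

context framed_representation
begin

lemma semidirect_dual: "novikov_algebra scl carrier prd"
  using novikov_representation.semidirect_novikov_algebra[OF
      dual_novikov_representation[OF novikov_representation_axioms]] .

lemma defect_bilinear:
  "defect (u + u') v = defect u v + defect u' v" "defect (t k u) v = s k (defect u v)"
  "defect u (v + v') = defect u v + defect u v'" "defect u (t k v) = s k (defect u v)"
  by (simp_all add: defect_def T.add T.scale mul_add_left mul_add_right mul_scale_left
      mul_scale_right l_add l_scale r_add r_scale l_add_arg r_add_arg l_scale_arg r_scale_arg
      scale_right_diff_distrib algebra_simps)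

text \<open>
  The defect is bilinear, so its values on basis vectors determine it.
\<close>

lemma defect_expansion:
  assumes "Vector_Spaces.linear s (*) \<xi>"
  shows "\<xi> (defect u v) = (\<Sum>i<m. \<Sum>j<m. \<epsilon> i u * \<epsilon> j v * \<xi> (defect (b i) (b j)))"
proof -
  have \<xi>: "\<xi> (a + c) = \<xi> a + \<xi> c" "\<xi> (s k a) = k * \<xi> a" for a c k
    using assms by (simp_all add: linear_functional_iff vector_space_axioms)
  have "\<xi> (defect u v) = (\<Sum>i<m. \<epsilon> i u * \<xi> (defect (b i) v))"
    by (rule additive_expansion) (simp_all add: defect_bilinear \<xi>)
  also have "\<dots> = (\<Sum>i<m. \<epsilon> i u * (\<Sum>j<m. \<epsilon> j v * \<xi> (defect (b i) (b j))))"
    by (intro sum.cong refl arg_cong2[where f = "(*)"], rule additive_expansion)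
      (simp_all add: defect_bilinear \<xi>)
  finally show ?thesis
    by (simp add: sum_distrib_left mult.assoc)
qed

lemma functional_nybe_expression:
  assumes lin: "Vector_Spaces.linear formal_scale (*) \<Phi>"
    and ml: "multilinear_form scl carrier 3 (\<lambda>xs. \<Phi> (formal_pure xs))"
  defines "\<tau> \<equiv> \<lambda>x y z. \<Phi> (formal_pure [x, y, z])"
  shows "\<Phi> (nybe_expression prd (m + m) left_leg right_leg) =
    (\<Sum>i<m. \<Sum>j<m. \<tau> (in_dual (\<epsilon> i)) (in_dual (\<epsilon> j)) (in_alg (defect (b i) (b j)))
       + \<tau> (in_alg (defect (b i) (b j))) (in_dual (\<epsilon> j)) (in_dual (\<epsilon> i))
       - \<tau> (in_dual (\<epsilon> i)) (in_alg (defect (b i) (b j) + defect (b j) (b i))) (in_dual (\<epsilon> j)))"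
proof -
  interpret \<Phi>: Vector_Spaces.linear formal_scale "(*)" \<Phi> by (rule lin)
  interpret F: framed_trilinear s mul t l r m b \<epsilon> T \<tau>
    unfolding \<tau>_def by (intro framed_trilinear.intro framed_representation_axioms
        multilinear_form_3_iff[THEN iffD1] ml)
  show ?thesis
    using F.nybe_term_total[unfolded F.nybe_term_def]
    unfolding nybe_expression_def \<Phi>.sum \<Phi>.add \<tau>_def .
qed

text \<open>
  If the expression is null, the form \<open>f \<otimes> g \<otimes> a \<mapsto> f u \<cdot> g v \<cdot> \<xi> a\<close> applied to it gives \<open>\<xi> (O(u, v))\<close>, for any
  linear functional \<open>\<xi>\<close> on the algebra, and functionals separate points. The converse reads the same
  formula under an arbitrary form.
\<close>

lemma nybe_expression_null_iff:
  "nybe_expression prd (m + m) left_leg right_leg \<in> null_tensors scl carrier 3 \<longleftrightarrow>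
    o_operator s mul t l r T"
proof
  assume null: "nybe_expression prd (m + m) left_leg right_leg \<in> null_tensors scl carrier 3"
  have "\<xi> (defect u v) = 0" if \<xi>: "Vector_Spaces.linear s (*) \<xi>" for \<xi> u v
  proof -
    \<comment> \<open>a form that sees only the component in \<open>V* \<otimes> V* \<otimes> A\<close>, where the defect stands alone\<close>
    let ?\<tau> = "\<lambda>x y z. snd x u * snd y v * \<xi> (fst z)"
    have "\<exists>\<Phi>. Vector_Spaces.linear formal_scale (*) \<Phi> \<and>
        (\<forall>xs. \<Phi> (formal_pure xs) = ?\<tau> (xs ! 0) (xs ! 1) (xs ! 2))"
      by (rule formal_linear_extension)
    then obtain \<Phi> where lin: "Vector_Spaces.linear formal_scale (*) \<Phi>"
      and \<Phi>: "\<forall>xs. \<Phi> (formal_pure xs) = ?\<tau> (xs ! 0) (xs ! 1) (xs ! 2)"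
      by (elim exE conjE)
    have \<xi>': "\<xi> (a + c) = \<xi> a + \<xi> c" "\<xi> (s k a) = k * \<xi> a" for a c k
      using \<xi> by (simp_all add: linear_functional_iff vector_space_axioms)
    have "trilinear_form scl carrier (\<lambda>x y z. \<Phi> (formal_pure [x, y, z]))"
      by unfold_locales (auto simp: \<Phi> \<xi>' sum_scale_def dual_scale_def algebra_simps)
    then have ml: "multilinear_form scl carrier 3 (\<lambda>xs. \<Phi> (formal_pure xs))"
      by (simp add: multilinear_form_3_iff)
    have "0 = \<Phi> (nybe_expression prd (m + m) left_leg right_leg)"
      using null lin ml by (simp add: null_tensors_iff_multilinear)
    also have "\<dots> = (\<Sum>i<m. \<Sum>j<m. \<epsilon> i u * \<epsilon> j v * \<xi> (defect (b i) (b j)))"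
      unfolding functional_nybe_expression[OF lin ml] by (simp add: \<Phi> in_alg_def in_dual_def)
    also have "\<dots> = \<xi> (defect u v)"
      by (rule defect_expansion[OF \<xi>, symmetric])
    finally show ?thesis by simp
  qed
  then have "defect u v \<in> span {}" for u v
    by (rule_tac ccontr, elim separating_functional[OF vector_space_axioms]) simp
  then show "o_operator s mul t l r T"
    by (simp add: o_operator_iff_defect)
next
  assume "o_operator s mul t l r T"
  then have "defect u v = 0" for u v
    by (simp add: o_operator_iff_defect)
  moreover have "in_alg 0 = 0" by (simp add: in_alg_def zero_prod_def)
  ultimately show "nybe_expression prd (m + m) left_leg right_leg \<in> null_tensors scl carrier 3"
    unfolding null_tensors_iff_multilinear
  proof (intro allI impI)
    fix \<Phi> :: "(('a \<times> ('v \<Rightarrow> 'k)) list \<Rightarrow>\<^sub>0 'k) \<Rightarrow> 'k"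
    assume d: "\<And>u v. defect u v = 0" "in_alg 0 = 0" and lin: "Vector_Spaces.linear formal_scale (*) \<Phi>"
      and ml: "multilinear_form scl carrier 3 (\<lambda>xs. \<Phi> (formal_pure xs))"
    interpret F: framed_trilinear s mul t l r m b \<epsilon> T "\<lambda>x y z. \<Phi> (formal_pure [x, y, z])"
      by (intro framed_trilinear.intro framed_representation_axioms
        multilinear_form_3_iff[THEN iffD1] ml)
    show "\<Phi> (nybe_expression prd (m + m) left_leg right_leg) = 0"
      unfolding functional_nybe_expression[OF lin ml]
      by (simp add: d F.\<tau>_zero carrier_mem coordinate_dual del: mem_Sigma_iff)
  qed
qed

end

lemma null_tensors_uminus_left:
  assumes "vector_space s" "x \<in> N" "y \<in> N"
  shows "formal_pure [- x, y] + formal_pure [x, y] \<in> null_tensors s N 2"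
proof -
  interpret vector_space s by fact
  have "\<Phi> (formal_pure [- x, y] + formal_pure [x, y]) = 0"
    if lin: "Vector_Spaces.linear formal_scale (*) \<Phi>"
      and ml: "multilinear_form s N 2 (\<lambda>xs. \<Phi> (formal_pure xs))" for \<Phi>
  proof -
    interpret \<Phi>: Vector_Spaces.linear formal_scale "(*)" \<Phi> by (rule lin)
    have "\<forall>us vs c x. set us \<subseteq> N \<longrightarrow> set vs \<subseteq> N \<longrightarrow> x \<in> N \<longrightarrow> length us + length vs + 1 = 2 \<longrightarrow>
        \<Phi> (formal_pure (us @ s c x # vs)) = c * \<Phi> (formal_pure (us @ x # vs))"
      using ml unfolding multilinear_form_def by (rule conjunct2)
    from this[rule_format, of "[]" "[y]" x "- 1"] assms
    have "\<Phi> (formal_pure [- x, y]) = - \<Phi> (formal_pure [x, y])" by simp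
    then show ?thesis by (simp add: \<Phi>.add)
  qed
  then show ?thesis by (simp add: null_tensors_iff_multilinear)
qed

lemma formal_flip_sum:
  fixes p :: "'i \<Rightarrow> ('n list \<Rightarrow>\<^sub>0 'k::field)"
  shows "formal_flip (sum p I) = (\<Sum>i\<in>I. formal_flip (p i))"
proof -
  have "formal_flip (q + q') = formal_flip q + formal_flip q'" for q q' :: "'n list \<Rightarrow>\<^sub>0 'k"
    by (simp add: formal_flip_def map_key_plus)
  moreover have "formal_flip 0 = (0 :: 'n list \<Rightarrow>\<^sub>0 'k)"
    by (rule poly_mapping_eqI) (simp add: formal_flip_def map_key.rep_eq)
  ultimately show ?thesis
    by (induction I rule: infinite_finite_induct) simp_all
qed

theorem theorem3p29:
  fixes sA :: "'k::field_char_0 \<Rightarrow> 'a::ab_group_add \<Rightarrow> 'a"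
    and sV :: "'k \<Rightarrow> 'v::ab_group_add \<Rightarrow> 'v"
    and mul :: "'a \<Rightarrow> 'a \<Rightarrow> 'a"
    and l r :: "'a \<Rightarrow> 'v \<Rightarrow> 'v"
    and T :: "'v \<Rightarrow> 'a"
  assumes "novikov_algebra sA UNIV mul"
    and "finite_dimensional_vector_space sA BA"
    and "novikov_representation sA UNIV mul sV UNIV l r"
    and "finite_dimensional_vector_space sV B"
    and "Vector_Spaces.linear sV sA T"
  shows "nybe (sum_scale sA dual_scale) (UNIV \<times> dual_space sV)
           (semidirect_mul mul (dual_action l + dual_action r) (- dual_action r))
           (tensor_class (sum_scale sA dual_scale) (UNIV \<times> dual_space sV) 2
              (formal_of_map sV B T - formal_flip (formal_of_map sV B T)))
         \<longleftrightarrow> o_operator sA mul sV l r T"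
proof -
  interpret V: finite_dimensional_vector_space sV B by fact
  interpret R: novikov_representation sA UNIV mul sV UNIV l r by fact
  obtain b where b: "bij_betw b {..<card B} B"
    using ex_bij_betw_nat_finite[OF V.finite_Basis] by (auto simp: atLeast0LessThan)
  define \<epsilon> where "\<epsilon> i v = V.representation B v (b i)" for i v
  interpret framed_representation sA mul sV l r "card B" b \<epsilon> T
  proof (intro framed_representation.intro dual_frame.intro dual_frame_axioms.intro
      framed_representation_axioms.intro R.novikov_representation_axioms V.vector_space_axioms)
    show "\<epsilon> i \<in> dual_space sV" for i
      by (simp add: dual_space_def linear_functional_iff[OF V.vector_space_axioms] \<epsilon>_def
          V.independent_Basis V.span_Basis V.representation_add V.representation_scale)
    fix v
    have "(\<Sum>i<card B. sV (\<epsilon> i v) (b i)) = (\<Sum>c\<in>B. sV (V.representation B v c) c)"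
      unfolding \<epsilon>_def by (rule sum.reindex_bij_betw[OF b])
    also have "\<dots> = v"
      by (rule V.sum_representation_eq) (simp_all add: V.independent_Basis V.span_Basis V.finite_Basis)
    finally show "(\<Sum>i<card B. sV (\<epsilon> i v) (b i)) = v" .
  qed fact
  interpret N: novikov_algebra scl carrier prd by (rule semidirect_dual)
  let ?m = "card B"
  have map: "formal_of_map sV B T = (\<Sum>i<?m. formal_pure [in_alg (T (b i)), in_dual (\<epsilon> i)])"
    unfolding formal_of_map_def \<epsilon>_def in_alg_def in_dual_def
    by (rule sum.reindex_bij_betw[OF b, symmetric])
  have flip: "formal_flip (formal_of_map sV B T) =
      (\<Sum>i<?m. formal_pure [in_dual (\<epsilon> i), in_alg (T (b i))])"
    unfolding map formal_flip_sum by (simp add: formal_flip_pure)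
  \<comment> \<open>the presentation by legs and the skew tensor differ only by moving the sign into a factor\<close>
  have "(\<Sum>i<?m + ?m. formal_pure [left_leg i, right_leg i]) -
      (formal_of_map sV B T - formal_flip (formal_of_map sV B T)) =
      (\<Sum>i<?m. formal_pure [- in_dual (\<epsilon> i), in_alg (T (b i))] +
        formal_pure [in_dual (\<epsilon> i), in_alg (T (b i))])"
    by (simp add: flip sum_lessThan_add left_leg_def right_leg_def sum.distrib) (simp add: map)
  also have "\<dots> \<in> null_tensors scl carrier 2"
    by (intro formal.subspace_sum subspace_null_tensors null_tensors_uminus_left
        N.vector_space_axioms carrier_mem coordinate_dual) simp
  finally have tensor: "tensor_class scl carrier 2 (formal_of_map sV B T - formal_flip (formal_of_map sV B T)) =
      tensor_class scl carrier 2 (\<Sum>i<?m + ?m. formal_pure [left_leg i, right_leg i])"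
    by (simp add: tensor_class_eq_iff[symmetric])
  show ?thesis
    unfolding tensor using N.nybe_iff[of "?m + ?m" left_leg right_leg] legs_carrier
      nybe_expression_null_iff
    by (simp add: tensor_class_eq_iff)
qed

end
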